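(* In the normalized two-sector model described in the context, the common growth rate along the steady state is $$r_*(\sigma_1)=\frac1\varepsilon\left[\frac{\bar y_1}{\bar k\bar v}\,\bar\pi_1^k\left(\frac{\bar\pi_1^k}{\pi_{1*}^k}\right)^{\frac{1-\psi_1}{\psi_1}}-\rho-\delta_k\right],\qquad \psi_1=\frac{\sigma_1-1}{\sigma_1},$$ and $r_*$ is an increasing function of the elasticity of substitution $\sigma_1$ if the ratio $\frac{kv}{hu}$ (at the steady state, $w_*$) is greater than the reference ratio $\bar w=\frac{\bar k\bar v}{\bar h\bar u}$, that is, if the physical-capital share $\pi_1^k$ of the goods sector is an increasing function of $\sigma_1$.
   Context: Model: maximize $\int_0^\infty \frac{c^{1-\varepsilon}-1}{1-\varepsilon}e^{-\rho t}dt$ subject to $\dot k=y_1-c-\delta_k k$, $\dot h=y_2-\delta_h h$, with $k(0),h(0)$ given. Here $c$ is consumption, $k$ is physical capital, $h$ is human capital, $v$ and $u$ are the fractions of $k$ and $h$ used in the goods sector, $\rho$ is the rate of time preference, $\delta_k,\delta_h$ are depreciation rates, and $\varepsilon>1$. The goods and education sectors have CES technologies $$y_1=A_1[\alpha_1(kv)^{\psi_1}+(1-\alpha_1)(hu)^{\psi_1}]^{1/\psi_1},\quad y_2=A_2\{\alpha_2[k(1-v)]^{\psi_2}+(1-\alpha_2)[h(1-u)]^{\psi_2}\}^{1/\psi_2},$$ with $\alpha_i\in(0,1)$ and $\psi_i=(\sigma_i-1)/\sigma_i<1$, where $\sigma_i$ is the elasticity of substitution of sector $i$. Put $w=\frac{kv}{hu}$,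 $\tau=\frac{v(1-u)}{u(1-v)}$, $\theta=\frac{\alpha_1(1-\alpha_2)}{\alpha_2(1-\alpha_1)}$, $P_1=\alpha_1w^{\psi_1}+1-\alpha_1$, $P_2=\alpha_2\theta^{-\frac{\psi_2}{1-\psi_2}}w^{\frac{\psi_2(1-\psi_1)}{1-\psi_2}}+1-\alpha_2$. The steady state (balanced growth path) is the regime in which $u$ and $v$ are constant; there $k,h,c,y_1,y_2$ grow at the common rate $$r_*=\frac1\varepsilon\left\{\alpha_1A_1w_*^{\psi_1-1}[\alpha_1w_*^{\psi_1}+1-\alpha_1]^{\frac1{\psi_1}-1}-\rho-\delta_k\right\},$$ where $w_*$, the steady-state value of $w$, is the solution of $$\alpha_1A_1w^{\psi_1-1}P_1^{\frac1{\psi_1}-1}-(1-\alpha_2)A_2P_2^{\frac1{\psi_2}-1}-(\delta_k-\delta_h)=0.$$ Normalization: for given baseline values $\bar k,\bar h,\bar u,\bar v,\bar y_1,\bar y_2$ and a marginal rate of substitution $m$ common to both sectors, with $\bar w=\frac{\bar k\bar v}{\bar h\bar u}$ and $\bar\tau=\frac{\bar v(1-\bar u)}{\bar u(1-\bar v)}$, the parameters are $$\alpha_1(\sigma_1)=\frac{\bar w^{1-\psi_1}}{\bar w^{1-\psi_1}+m},\quad A_1(\sigma_1)=\frac{\bar y_1}{\bar h\bar u}\left[\frac{\bar w^{1-\psi_1}+m}{\bar w+m}\right]^{\frac1{\psi_1}},$$ $$\alpha_2(\sigma_2)=\frac{(\bar w/\bar\tau)^{1-\psi_2}}{(\bar w/\bar\tau)^{1-\psi_2}+m},\quad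 A_2(\sigma_2)=\frac{\bar y_2}{\bar h(1-\bar u)}\left[\frac{(\bar w/\bar\tau)^{1-\psi_2}+m}{\bar w/\bar\tau+m}\right]^{\frac1{\psi_2}}.$$ The physical-capital share of the goods sector is $\pi_1^k=\frac{\bar w^{1-\psi_1}w^{\psi_1}}{\bar w^{1-\psi_1}w^{\psi_1}+m}$; $\pi_{1*}^k$ is its value at $w=w_*$, and $\bar\pi_1^k=\frac{\bar w}{\bar w+m}$ is its baseline value. *)

theory Defs
  imports Complex_Main
begin

section \<open>Two-sector growth model with CES technologies\<close>

record technology =
  A1 :: real
  alpha1 :: real
  psi1 :: real
  A2 :: real
  alpha2 :: real
  psi2 :: real

record environment =
  eps :: real
  rho :: real
  dk :: real
  dh :: real

text \<open>The CES formulas divide by the exponent \<open>\<psi>\<close>. They are used only for \<open>\<psi> \<noteq> 0\<close>, that is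
  for an elasticity of substitution \<open>\<sigma> \<noteq> 1\<close>, and for positive inputs.\<close>

definition ces :: "real \<Rightarrow> real \<Rightarrow> real \<Rightarrow> real \<Rightarrow> real \<Rightarrow> real" where
  "ces A \<alpha> \<psi> x y = A * (\<alpha> * x powr \<psi> + (1 - \<alpha>) * y powr \<psi>) powr (1 / \<psi>)"

definition goods :: "technology \<Rightarrow> real \<Rightarrow> real \<Rightarrow> real \<Rightarrow> real \<Rightarrow> real" where
  "goods T k h u v = ces (A1 T) (alpha1 T) (psi1 T) (k * v) (h * u)"

definition education :: "technology \<Rightarrow> real \<Rightarrow> real \<Rightarrow> real \<Rightarrow> real \<Rightarrow> real" where
  "education T k h u v = ces (A2 T) (alpha2 T) (psi2 T) (k * (1 - v)) (h * (1 - u))"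

definition utility :: "environment \<Rightarrow> real \<Rightarrow> real" where
  "utility E c = (c powr (1 - eps E) - 1) / (1 - eps E)"


section \<open>Optimality conditions and balanced growth paths\<close>

definition hamiltonian ::
  "environment \<Rightarrow> technology \<Rightarrow> real \<Rightarrow> real \<Rightarrow> real \<Rightarrow> real \<Rightarrow> real \<Rightarrow> real \<Rightarrow> real \<Rightarrow> real" where
  "hamiltonian E T k h c u v lam mu =
     utility E c + lam * (goods T k h u v - c - dk E * k) + mu * (education T k h u v - dh E * h)"

definition feasible_path ::
  "environment \<Rightarrow> technology \<Rightarrow> (real \<Rightarrow> real) \<Rightarrow> (real \<Rightarrow> real) \<Rightarrow> (real \<Rightarrow> real)
     \<Rightarrow> (real \<Rightarrow> real) \<Rightarrow> (real \<Rightarrow> real) \<Rightarrow> bool" where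
  "feasible_path E T k h c u v \<longleftrightarrow> (\<forall>t\<ge>0.
      0 < k t \<and> 0 < h t \<and> 0 < c t \<and> 0 < u t \<and> u t < 1 \<and> 0 < v t \<and> v t < 1 \<and>
      (k has_real_derivative goods T (k t) (h t) (u t) (v t) - c t - dk E * k t) (at t within {0..}) \<and>
      (h has_real_derivative education T (k t) (h t) (u t) (v t) - dh E * h t) (at t within {0..}))"

text \<open>Interior first-order conditions of the (current-value) maximum principle for maximizing the
  discounted utility integral. They are necessary for an interior optimum; the transversality
  conditions are not needed and are left out.\<close>

definition maximum_principle ::
  "environment \<Rightarrow> technology \<Rightarrow> (real \<Rightarrow> real) \<Rightarrow> (real \<Rightarrow> real) \<Rightarrow> (real \<Rightarrow> real)
     \<Rightarrow> (real \<Rightarrow> real) \<Rightarrow> (real \<Rightarrow> real) \<Rightarrow> (real \<Rightarrow> real) \<Rightarrow> (real \<Rightarrow> real) \<Rightarrow> bool" where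
  "maximum_principle E T k h c u v lam mu \<longleftrightarrow> (\<forall>t\<ge>0.
      ((\<lambda>x. hamiltonian E T (k t) (h t) x (u t) (v t) (lam t) (mu t))
         has_real_derivative 0) (at (c t)) \<and>
      ((\<lambda>x. hamiltonian E T (k t) (h t) (c t) x (v t) (lam t) (mu t))
         has_real_derivative 0) (at (u t)) \<and>
      ((\<lambda>x. hamiltonian E T (k t) (h t) (c t) (u t) x (lam t) (mu t))
         has_real_derivative 0) (at (v t)) \<and>
      (\<exists>Hk. ((\<lambda>x. hamiltonian E T x (h t) (c t) (u t) (v t) (lam t) (mu t))
               has_real_derivative Hk) (at (k t)) \<and>
            (lam has_real_derivative rho E * lam t - Hk) (at t within {0..})) \<and>
      (\<exists>Hh. ((\<lambda>x. hamiltonian E T (k t) x (c t) (u t) (v t) (lam t) (mu t))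
               has_real_derivative Hh) (at (h t)) \<and>
            (mu has_real_derivative rho E * mu t - Hh) (at t within {0..})))"

definition grows_at :: "(real \<Rightarrow> real) \<Rightarrow> real \<Rightarrow> bool" where
  "grows_at x g \<longleftrightarrow> (\<forall>t\<ge>0. (x has_real_derivative g * x t) (at t within {0..}))"

text \<open>The growth rates are not required to coincide: that they do is part of the claim.\<close>

definition balanced_growth_path ::
  "environment \<Rightarrow> technology \<Rightarrow> (real \<Rightarrow> real) \<Rightarrow> (real \<Rightarrow> real) \<Rightarrow> (real \<Rightarrow> real)
     \<Rightarrow> (real \<Rightarrow> real) \<Rightarrow> (real \<Rightarrow> real) \<Rightarrow> bool" where
  "balanced_growth_path E T k h c u v \<longleftrightarrow>
     feasible_path E T k h c u v \<and>
     (\<exists>lam mu. maximum_principle E T k h c u v lam mu) \<and>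
     (\<forall>t\<ge>0. u t = u 0 \<and> v t = v 0) \<and>
     (\<exists>g. grows_at k g) \<and> (\<exists>g. grows_at h g) \<and> (\<exists>g. grows_at c g)"


section \<open>Steady state\<close>

definition theta :: "technology \<Rightarrow> real" where
  "theta T = alpha1 T * (1 - alpha2 T) / (alpha2 T * (1 - alpha1 T))"

definition P1 :: "technology \<Rightarrow> real \<Rightarrow> real" where
  "P1 T w = alpha1 T * w powr psi1 T + 1 - alpha1 T"

definition P2 :: "technology \<Rightarrow> real \<Rightarrow> real" where
  "P2 T w = alpha2 T * theta T powr (- (psi2 T / (1 - psi2 T)))
              * w powr (psi2 T * (1 - psi1 T) / (1 - psi2 T)) + 1 - alpha2 T"

definition steady_state :: "environment \<Rightarrow> technology \<Rightarrow> real \<Rightarrow> bool" where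
  "steady_state E T w \<longleftrightarrow> 0 < w \<and>
     alpha1 T * A1 T * w powr (psi1 T - 1) * P1 T w powr (1 / psi1 T - 1)
     - (1 - alpha2 T) * A2 T * P2 T w powr (1 / psi2 T - 1) - (dk E - dh E) = 0"

text \<open>A steady state need not exist for all parameters. When one exists it is unique, because the
  left-hand side of the equation is strictly decreasing in \<open>w\<close>.\<close>

definition steady_w :: "environment \<Rightarrow> technology \<Rightarrow> real" where
  "steady_w E T = (THE w. steady_state E T w)"

definition steady_growth :: "environment \<Rightarrow> technology \<Rightarrow> real" where
  "steady_growth E T = (let w = steady_w E T in
     1 / eps E * (alpha1 T * A1 T * w powr (psi1 T - 1)
       * (alpha1 T * w powr psi1 T + 1 - alpha1 T) powr (1 / psi1 T - 1) - rho E - dk E))"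


section \<open>Normalization\<close>

record baseline =
  kbar :: real
  hbar :: real
  ubar :: real
  vbar :: real
  y1bar :: real
  y2bar :: real
  mrs :: real

definition valid_baseline :: "baseline \<Rightarrow> bool" where
  "valid_baseline B \<longleftrightarrow> 0 < kbar B \<and> 0 < hbar B \<and> 0 < ubar B \<and> ubar B < 1 \<and> 0 < vbar B \<and> vbar B < 1
     \<and> 0 < y1bar B \<and> 0 < y2bar B \<and> 0 < mrs B"

definition wbar :: "baseline \<Rightarrow> real" where
  "wbar B = kbar B * vbar B / (hbar B * ubar B)"

definition taubar :: "baseline \<Rightarrow> real" where
  "taubar B = vbar B * (1 - ubar B) / (ubar B * (1 - vbar B))"

definition psi :: "real \<Rightarrow> real" where
  "psi \<sigma> = (\<sigma> - 1) / \<sigma>"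

definition norm_alpha :: "real \<Rightarrow> real \<Rightarrow> real \<Rightarrow> real" where
  "norm_alpha m x \<psi> = x powr (1 - \<psi>) / (x powr (1 - \<psi>) + m)"

definition norm_A :: "real \<Rightarrow> real \<Rightarrow> real \<Rightarrow> real \<Rightarrow> real" where
  "norm_A m a x \<psi> = a * ((x powr (1 - \<psi>) + m) / (x + m)) powr (1 / \<psi>)"

definition normalized :: "baseline \<Rightarrow> real \<Rightarrow> real \<Rightarrow> technology" where
  "normalized B \<sigma>1 \<sigma>2 =
     \<lparr> A1 = norm_A (mrs B) (y1bar B / (hbar B * ubar B)) (wbar B) (psi \<sigma>1),
       alpha1 = norm_alpha (mrs B) (wbar B) (psi \<sigma>1),
       psi1 = psi \<sigma>1,
       A2 = norm_A (mrs B) (y2bar B / (hbar B * (1 - ubar B))) (wbar B / taubar B) (psi \<sigma>2),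
       alpha2 = norm_alpha (mrs B) (wbar B / taubar B) (psi \<sigma>2),
       psi2 = psi \<sigma>2 \<rparr>"

definition k_share :: "baseline \<Rightarrow> real \<Rightarrow> real \<Rightarrow> real" where
  "k_share B \<sigma>1 w = wbar B powr (1 - psi \<sigma>1) * w powr psi \<sigma>1
                      / (wbar B powr (1 - psi \<sigma>1) * w powr psi \<sigma>1 + mrs B)"

definition k_share_bar :: "baseline \<Rightarrow> real" where
  "k_share_bar B = wbar B / (wbar B + mrs B)"

definition w_star :: "environment \<Rightarrow> baseline \<Rightarrow> real \<Rightarrow> real \<Rightarrow> real" where
  "w_star E B \<sigma>2 \<sigma>1 = steady_w E (normalized B \<sigma>1 \<sigma>2)"

definition r_star :: "environment \<Rightarrow> baseline \<Rightarrow> real \<Rightarrow> real \<Rightarrow> real" where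
  "r_star E B \<sigma>2 \<sigma>1 = steady_growth E (normalized B \<sigma>1 \<sigma>2)"

definition k_share_star :: "environment \<Rightarrow> baseline \<Rightarrow> real \<Rightarrow> real \<Rightarrow> real" where
  "k_share_star E B \<sigma>2 \<sigma>1 = k_share B \<sigma>1 (w_star E B \<sigma>2 \<sigma>1)"

definition elasticities :: "environment \<Rightarrow> baseline \<Rightarrow> real \<Rightarrow> real set" where
  "elasticities E B \<sigma>2 = {\<sigma>1. 0 < \<sigma>1 \<and> \<sigma>1 \<noteq> 1 \<and> (\<exists>w. steady_state E (normalized B \<sigma>1 \<sigma>2) w)}"

definition increasing_at :: "(real \<Rightarrow> real) \<Rightarrow> real \<Rightarrow> bool" where
  "increasing_at f x \<longleftrightarrow> (\<exists>D>0. (f has_real_derivative D) (at x))"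

end

theory Submission
  imports Defs
begin

text \<open>In the variable \<open>y = ln (w / W) / \<sigma>1\<close>, with \<open>W\<close> the baseline ratio, the steady-state equation of the
  normalized model becomes \<open>C1 * M (\<sigma>1 - 1) y - G y = dk - dh\<close>. Here \<open>M s y\<close> is a weighted power mean
  of order \<open>s\<close> of the numbers \<open>1\<close> and \<open>exp (- y)\<close>, so it is decreasing in \<open>y\<close> and, for \<open>y \<noteq> 0\<close>, strictly
  increasing in \<open>s\<close>, while \<open>G\<close> is increasing and does not depend on \<open>\<sigma>1\<close>. Hence the solution \<open>y\<close>
  increases with \<open>\<sigma>1\<close>, and so does the growth rate \<open>(G y - rho - dh) / eps\<close>. The capital share is an
  increasing function of \<open>z = (\<sigma>1 - 1) * y\<close>, and implicit differentiation shows that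
  \<open>dz / d\<sigma>1\<close> has the sign of \<open>y\<close>.

  On a balanced growth path the costate of \<open>k\<close> is \<open>c powr - eps\<close>. Its Euler equation makes the marginal
  product of capital constant in time, which fixes \<open>kv / hu\<close>; the costate of \<open>h\<close> is then proportional
  to that of \<open>k\<close>, and equating their growth rates gives the steady-state equation.\<close>

section \<open>Power means of two numbers\<close>

definition mix :: "real \<Rightarrow> real \<Rightarrow> real" where
  "mix b z = b + (1 - b) * exp (- z)"

text \<open>The relative weight of the second term of \<open>mix b z\<close>, and so minus the
  derivative of \<open>ln (mix b z)\<close> in \<open>z\<close>: the slope in all tangent
  inequalities below.\<close>

definition tilt :: "real \<Rightarrow> real \<Rightarrow> real" where
  "tilt b z = (1 - b) * exp (- z) / mix b z"

definition pmean :: "real \<Rightarrow> real \<Rightarrow> real \<Rightarrow> real" where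
  "pmean b s y = mix b (s * y) powr (1 / s)"

lemma mix_pos: "0 < b \<Longrightarrow> b < 1 \<Longrightarrow> 0 < mix b z"
  by (simp add: mix_def add_pos_pos)

lemma mix_0 [simp]: "mix b 0 = 1"
  by (simp add: mix_def)

lemma tilt_bounds:
  assumes "0 < b" "b < 1"
  shows "0 < tilt b z" "tilt b z < 1"
  using assms mix_pos[OF assms, of z] by (simp_all add: tilt_def mix_def divide_simps)

lemma ln_mix_tangent:
  assumes b: "0 < b" "b < 1" and "z \<noteq> 0"
  shows "- (1 - b) * z < ln (mix b z)"
proof -
  define D where "D = mix b z"
  have D: "0 < D" using mix_pos[OF b] by (simp add: D_def)
  have "exp (- z) \<noteq> 1" using \<open>z \<noteq> 0\<close> by simp
  then have "(1 - b) * (exp (- z) - 1) \<noteq> 0" using b by simp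
  then have "D \<noteq> 1" by (simp add: D_def mix_def algebra_simps)
  \<comment> \<open>Gibbs' inequality for the weights \<open>b\<close>, \<open>1 - b\<close> and \<open>b / D\<close>, \<open>(1 - b) * exp (- z) / D\<close>\<close>
  have 1: "ln (1 / D) < 1 / D - 1"
    using ln_le_minus_one[of "1/D"] ln_eq_minus_one[of "1/D"] D \<open>D \<noteq> 1\<close> by fastforce
  have 2: "ln (exp (- z) / D) \<le> exp (- z) / D - 1"
    using D by (intro ln_le_minus_one) simp
  have "b * ln (1 / D) + (1 - b) * ln (exp (- z) / D)
      < b * (1 / D - 1) + (1 - b) * (exp (- z) / D - 1)"
    using b 1 2 by (intro add_less_le_mono mult_strict_left_mono mult_left_mono) auto
  also have "\<dots> = (b + (1 - b) * exp (- z)) / D - 1"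
    by (simp add: diff_divide_distrib add_divide_distrib algebra_simps)
  also have "\<dots> = 0" using D by (simp add: D_def mix_def)
  finally show ?thesis using D by (simp add: ln_div D_def[symmetric] algebra_simps)
qed

text \<open>Strict convexity of \<open>ln (mix b z)\<close> as a tangent inequality. Dividing by
  \<open>mix b z\<close> moves the base point to \<open>0\<close> and replaces the weight
  \<open>b\<close> by \<open>1 - tilt b z\<close>, so the tangent at \<open>0\<close> yields all
  others.\<close>

lemma ln_mix_gradient:
  assumes b: "0 < b" "b < 1" and "z \<noteq> z'"
  shows "ln (mix b z) - tilt b z * (z' - z) < ln (mix b z')"
proof -
  note q = tilt_bounds[OF b, of z]
  have "- (1 - (1 - tilt b z)) * (z' - z) < ln (mix (1 - tilt b z) (z' - z))"
    using q \<open>z \<noteq> z'\<close> by (intro ln_mix_tangent) auto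
  moreover have "mix (1 - tilt b z) (z' - z) = mix b z' / mix b z"
  proof -
    have "mix (1 - tilt b z) (z' - z) * mix b z
        = mix b z - tilt b z * mix b z + tilt b z * mix b z * exp (z - z')"
      unfolding mix_def[of "1 - tilt b z"] by (simp add: algebra_simps)
    also have "tilt b z * mix b z = (1 - b) * exp (- z)"
      using mix_pos[OF b, of z] by (simp add: tilt_def)
    also have "mix b z - (1 - b) * exp (- z) + (1 - b) * exp (- z) * exp (z - z') = mix b z'"
      by (simp add: mix_def mult.assoc flip: exp_add)
    finally show ?thesis using mix_pos[OF b, of z] by (simp add: field_simps)
  qed
  ultimately show ?thesis
    using mix_pos[OF b, of z] mix_pos[OF b, of z'] by (simp add: ln_div)
qed

text \<open>Chords from the origin of a strictly convex function vanishing at \<open>0\<close> have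
  increasing slopes. For equal signs, the tangent at the argument nearer to \<open>0\<close> is
  compared with the values at \<open>0\<close> and at the other argument; for opposite signs, the
  tangent at \<open>0\<close> separates the slopes.\<close>

lemma ln_mix_slope_strict_mono:
  assumes b: "0 < b" "b < 1" and z: "z \<noteq> 0" "z' \<noteq> 0" "z < z'"
  shows "ln (mix b z) / z < ln (mix b z') / z'"
proof -
  consider "0 < z" | "z' < 0" | "z < 0" "0 < z'" using z by linarith
  then show ?thesis
  proof cases
    case 1
    have g: "ln (mix b z) + tilt b z * z < 0"
      using ln_mix_gradient[OF b, of z 0] 1 by simp
    have "z' * ln (mix b z) = z * ln (mix b z) + (z' - z) * ln (mix b z)" by algebra
    also have "\<dots> < z * ln (mix b z) + (z' - z) * (- (tilt b z * z))"
      using g z by (intro add_strict_left_mono mult_strict_left_mono) auto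
    also have "\<dots> = z * (ln (mix b z) - tilt b z * (z' - z))" by algebra
    also have "\<dots> < z * ln (mix b z')"
      using 1 z ln_mix_gradient[OF b, of z z'] by (intro mult_strict_left_mono) auto
    finally show ?thesis using 1 z by (simp add: divide_simps mult.commute)
  next
    case 2
    have g: "ln (mix b z') + tilt b z' * z' < 0"
      using ln_mix_gradient[OF b, of z' 0] 2 by simp
    have "z' * ln (mix b z) < z' * (ln (mix b z') - tilt b z' * (z - z'))"
      using 2 z ln_mix_gradient[OF b, of z' z] by (intro mult_strict_left_mono_neg) auto
    also have "\<dots> = z' * ln (mix b z') + (z' - z) * (tilt b z' * z')" by algebra
    also have "\<dots> < z' * ln (mix b z') + (z' - z) * (- ln (mix b z'))"
      using g z by (intro add_strict_left_mono mult_strict_left_mono) auto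
    also have "\<dots> = z * ln (mix b z')" by algebra
    finally show ?thesis using 2 z by (simp add: divide_simps mult.commute)
  next
    case 3
    have "ln (mix b z) / z < - (1 - b)"
      using ln_mix_tangent[OF b, of z] 3 by (simp add: divide_simps)
    also have "- (1 - b) < ln (mix b z') / z'"
      using ln_mix_tangent[OF b, of z'] 3 by (simp add: divide_simps)
    finally show ?thesis .
  qed
qed

lemma pmean_pos: "0 < b \<Longrightarrow> b < 1 \<Longrightarrow> 0 < pmean b s y"
  using mix_pos[of b "s * y"] by (simp add: pmean_def)

lemma ln_pmean:
  assumes "0 < b" "b < 1"
  shows "ln (pmean b s y) = ln (mix b (s * y)) / s"
  using mix_pos[OF assms, of "s * y"] by (simp add: pmean_def ln_powr)

text \<open>The strict power mean inequality for the distinct numbers \<open>1\<close> and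
  \<open>exp (- y)\<close>. The logarithm of the mean of order \<open>r\<close> is \<open>y\<close>
  times the chord slope at \<open>r * y\<close>; a negative \<open>y\<close> reverses both the order
  of the arguments and the effect of the factor.\<close>

lemma pmean_strict_mono_exponent:
  assumes b: "0 < b" "b < 1" and "y \<noteq> 0" and s: "s \<noteq> 0" "s' \<noteq> 0" "s < s'"
  shows "pmean b s y < pmean b s' y"
proof -
  have eq: "ln (pmean b r y) = y * (ln (mix b (r * y)) / (r * y))" for r
    using \<open>y \<noteq> 0\<close> by (simp add: ln_pmean[OF b])
  have "ln (pmean b s y) < ln (pmean b s' y)"
  proof (cases "y > 0")
    case True
    then show ?thesis unfolding eq using s
      by (intro mult_strict_left_mono ln_mix_slope_strict_mono[OF b]) auto
  next
    case False
    with \<open>y \<noteq> 0\<close> show ?thesis unfolding eq using s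
      by (intro mult_strict_left_mono_neg ln_mix_slope_strict_mono[OF b]) auto
  qed
  then show ?thesis using pmean_pos[OF b] by simp
qed

lemma DERIV_ln_mix:
  assumes b: "0 < b" "b < 1" and "(f has_real_derivative D) (at x)"
  shows "((\<lambda>x. ln (mix b (f x))) has_real_derivative - tilt b (f x) * D) (at x)"
proof -
  have "((\<lambda>z. ln (mix b z)) has_real_derivative - tilt b z) (at z)" for z
    using mix_pos[OF b, of z] unfolding mix_def[abs_def] tilt_def
    by (auto intro!: derivative_eq_intros)
  from DERIV_chain2[OF this assms(3)] show ?thesis .
qed

text \<open>The order \<open>s\<close> occurs in the base and in the exponent; the exponential form
  lets one chain rule treat both.\<close>

lemma pmean_eq_exp:
  assumes "0 < b" "b < 1"
  shows "pmean b s y = exp (ln (mix b (s * y)) / s)"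
  using mix_pos[OF assms, of "s * y"] by (simp add: pmean_def powr_def)

lemma DERIV_pmean:
  assumes b: "0 < b" "b < 1" and s: "s \<noteq> 0"
  shows "(pmean b s has_real_derivative - (tilt b (s * y) * pmean b s y)) (at y)"
proof -
  have "((\<lambda>y. ln (mix b (s * y))) has_real_derivative - tilt b (s * y) * s) (at y)"
    by (rule DERIV_ln_mix[OF b]) (auto intro!: derivative_eq_intros)
  from DERIV_fun_exp[OF DERIV_cdivide[OF this, of s]] show ?thesis
    using s unfolding pmean_eq_exp[OF b, abs_def] by (simp add: mult.commute)
qed

lemma DERIV_pmean_exponent:
  assumes b: "0 < b" "b < 1" and s: "s \<noteq> 0"
  shows "((\<lambda>s. pmean b s y) has_real_derivative
    - pmean b s y * (ln (mix b (s * y)) + tilt b (s * y) * (s * y)) / s\<^sup>2) (at s)"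
proof -
  have "((\<lambda>s. ln (mix b (s * y))) has_real_derivative - tilt b (s * y) * y) (at s)"
    by (rule DERIV_ln_mix[OF b]) (auto intro!: derivative_eq_intros)
  from DERIV_fun_exp[OF DERIV_divide[OF this DERIV_ident s]] show ?thesis
    unfolding pmean_eq_exp[OF b, abs_def]
    by (rule DERIV_cong) (simp add: power2_eq_square divide_simps algebra_simps)
qed

lemma DERIV_pmean_exponent_pos:
  assumes b: "0 < b" "b < 1" and s: "s \<noteq> 0" and y: "y \<noteq> 0"
  shows "0 < - pmean b s y * (ln (mix b (s * y)) + tilt b (s * y) * (s * y)) / s\<^sup>2"
proof -
  \<comment> \<open>The left side is the tangent at \<open>s * y\<close> evaluated at
    \<open>0\<close>, hence below \<open>ln (mix b 0) = 0\<close>.\<close>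
  have "ln (mix b (s * y)) + tilt b (s * y) * (s * y) < 0"
    using ln_mix_gradient[OF b, of "s * y" 0] s y by simp
  then show ?thesis using pmean_pos[OF b, of s y] s
    by (simp add: mult_pos_neg divide_neg_pos)
qed

lemma pmean_strict_antimono:
  assumes b: "0 < b" "b < 1" and s: "s \<noteq> 0" and "y < y'"
  shows "pmean b s y' < pmean b s y"
proof (rule DERIV_neg_imp_decreasing[OF \<open>y < y'\<close>])
  fix x
  show "\<exists>D. (pmean b s has_real_derivative D) (at x) \<and> D < 0"
    using DERIV_pmean[OF b s, of x] tilt_bounds[OF b, of "s * x"] pmean_pos[OF b, of s x]
    by (intro exI conjI) (auto simp: mult_pos_pos)
qed

lemma pmean_0 [simp]: "pmean b s 0 = 1"
  by (simp add: pmean_def)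

text \<open>With \<open>f\<close> and \<open>g\<close> built from the coordinates of a pair, this
  gives the joint continuity in order and argument that \<open>DERIV_implicit\<close> asks
  for.\<close>

lemma isCont_tilt_pmean:
  assumes b: "0 < b" "b < 1" and f: "isCont f x" "f x \<noteq> 0" and g: "isCont g x"
  shows "isCont (\<lambda>x. tilt b (f x * g x) * pmean b (f x) (g x)) x"
proof -
  have "0 < b + (1 - b) * exp (- (f x * g x))" using mix_pos[OF b] by (simp add: mix_def)
  then have n: "b + (1 - b) * exp (- (f x * g x)) \<noteq> 0" by simp
  show ?thesis unfolding pmean_def tilt_def mix_def
    by (intro continuous_intros f g n)
qed

section \<open>Zeros of a monotone function depending on a parameter\<close>

text \<open>Implicit differentiation along a level curve already known to be continuous. The mean
  value theorem in the second variable writes the change of \<open>F s\<close> as an exact product,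
  so joint continuity of \<open>F'\<close> at the base point suffices.\<close>

lemma DERIV_implicit:
  fixes F F' :: "real \<Rightarrow> real \<Rightarrow> real" and \<phi> :: "real \<Rightarrow> real"
  assumes A: "((\<lambda>s. F s (\<phi> s0)) has_real_derivative A) (at s0)"
    and F': "\<forall>\<^sub>F s in at s0. \<forall>y. (F s has_real_derivative F' s y) (at y)"
    and cont: "isCont (\<lambda>p. F' (fst p) (snd p)) (s0, \<phi> s0)"
    and nz: "F' s0 (\<phi> s0) \<noteq> 0"
    and phi: "isCont \<phi> s0" "\<forall>\<^sub>F s in at s0. F s (\<phi> s) = F s0 (\<phi> s0)"
  shows "(\<phi> has_real_derivative - A / F' s0 (\<phi> s0)) (at s0)"
proof -
  define y0 where "y0 = \<phi> s0"
  have "\<forall>\<^sub>F s in at s0. \<exists>\<xi>. \<bar>\<xi> - y0\<bar> \<le> \<bar>\<phi> s - y0\<bar> \<and>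
      F s (\<phi> s) - F s y0 = (\<phi> s - y0) * F' s \<xi>"
    using F'
  proof eventually_elim
    case (elim s)
    consider "\<phi> s = y0" | "y0 < \<phi> s" | "\<phi> s < y0" by linarith
    then show ?case
    proof cases
      case 2
      then show ?thesis using MVT2[OF 2, of "F s" "F' s"] elim by force
    next
      case 3
      then obtain \<xi> where "\<phi> s < \<xi>" "\<xi> < y0" "F s y0 - F s (\<phi> s) = (y0 - \<phi> s) * F' s \<xi>"
        using MVT2[OF 3, of "F s" "F' s"] elim by blast
      then show ?thesis by (intro exI[of _ \<xi>]) (auto simp: algebra_simps)
    qed auto
  qed
  \<comment> \<open>The intermediate points become a function of \<open>s\<close>, squeezed towards
    \<open>y0\<close> by the continuity of \<open>\<phi>\<close>.\<close>
  then obtain \<xi> where \<xi>: "\<forall>\<^sub>F s in at s0. \<bar>\<xi> s - y0\<bar> \<le> \<bar>\<phi> s - y0\<bar> \<and>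
      F s (\<phi> s) - F s y0 = (\<phi> s - y0) * F' s (\<xi> s)"
    unfolding eventually_ex by blast
  have phi_lim: "(\<phi> \<longlongrightarrow> y0) (at s0)" using phi(1) by (simp add: isCont_def y0_def)
  have "((\<lambda>s. \<xi> s - y0) \<longlongrightarrow> 0) (at s0)"
  proof (rule tendsto_0_le)
    show "\<forall>\<^sub>F s in at s0. norm (\<xi> s - y0) \<le> norm (\<phi> s - y0) * 1"
      using \<xi> by eventually_elim simp
    show "((\<lambda>s. \<phi> s - y0) \<longlongrightarrow> 0) (at s0)"
      using phi_lim by (simp add: LIM_zero_iff)
  qed
  then have "(\<xi> \<longlongrightarrow> y0) (at s0)" by (simp add: LIM_zero_iff)
  then have "((\<lambda>s. (s, \<xi> s)) \<longlongrightarrow> (s0, y0)) (at s0)" by (intro tendsto_intros)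
  then have lim: "((\<lambda>s. F' s (\<xi> s)) \<longlongrightarrow> F' s0 y0) (at s0)"
    using isCont_tendsto_compose[OF cont, of "\<lambda>s. (s, \<xi> s)"] by (simp add: y0_def)
  then have ev: "\<forall>\<^sub>F s in at s0. F' s (\<xi> s) \<noteq> 0"
    using nz by (intro tendsto_imp_eventually_ne) (auto simp: y0_def)
  \<comment> \<open>On the level curve \<open>F s (\<phi> s)\<close> equals \<open>F s0 y0\<close>,
    so this expression is the difference quotient of \<open>\<phi>\<close> wherever
    \<open>F' s (\<xi> s)\<close> is nonzero.\<close>
  have "((\<lambda>s. - ((F s y0 - F s0 y0) / (s - s0)) / F' s (\<xi> s)) \<longlongrightarrow> - A / F' s0 y0) (at s0)"
    using A lim nz unfolding has_field_derivative_iff y0_def[symmetric] by (intro tendsto_intros)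
  then have "((\<lambda>s. (\<phi> s - y0) / (s - s0)) \<longlongrightarrow> - A / F' s0 y0) (at s0)"
  proof (rule Lim_transform_eventually)
    have "\<forall>\<^sub>F s in at s0. s \<noteq> s0" by (simp add: eventually_at_filter)
    then show "\<forall>\<^sub>F s in at s0. - ((F s y0 - F s0 y0) / (s - s0)) / F' s (\<xi> s) = (\<phi> s - y0) / (s - s0)"
      using \<xi> ev phi(2)
    proof eventually_elim
      case (elim s)
      then have "- (F s y0 - F s0 y0) = (\<phi> s - y0) * F' s (\<xi> s)"
        unfolding y0_def[symmetric] by simp
      with elim show ?case by (simp add: minus_divide_left)
    qed
  qed
  then show ?thesis by (simp add: has_field_derivative_iff y0_def)
qed

text \<open>Strict decrease at \<open>s0\<close> gives opposite signs at \<open>y0 - e\<close> and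
  \<open>y0 + e\<close>. These persist for nearby \<open>s\<close>, and the intermediate value
  theorem supplies a zero between.\<close>

lemma eventually_zero_near:
  fixes F :: "real \<Rightarrow> real \<Rightarrow> real"
  assumes x: "\<And>y. isCont (\<lambda>s. F s y) s0"
    and y: "\<forall>\<^sub>F s in nhds s0. \<forall>y. isCont (F s) y"
    and anti: "\<And>y y'. y < y' \<Longrightarrow> F s0 y' < F s0 y"
    and zero: "F s0 y0 = 0" and "0 < e"
  shows "\<forall>\<^sub>F s in nhds s0. \<exists>y. \<bar>y - y0\<bar> \<le> e \<and> F s y = 0"
proof -
  have "F s0 (y0 + e) < 0" "0 < F s0 (y0 - e)"
    using anti[of y0 "y0 + e"] anti[of "y0 - e" y0] zero \<open>0 < e\<close> by auto
  moreover have lim: "((\<lambda>s. F s y) \<longlongrightarrow> F s0 y) (nhds s0)" for y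
    using x[of y] tendsto_at_iff_tendsto_nhds[of "\<lambda>s. F s y" s0] by (simp add: isCont_def)
  ultimately have "\<forall>\<^sub>F s in nhds s0. F s (y0 + e) < 0" "\<forall>\<^sub>F s in nhds s0. 0 < F s (y0 - e)"
    by (auto intro: order_tendstoD[OF lim])
  then show ?thesis using y
  proof eventually_elim
    case (elim s)
    then have "\<exists>y\<ge>y0 - e. y \<le> y0 + e \<and> F s y = 0"
      using \<open>0 < e\<close> by (intro IVT2) auto
    then obtain y where "y0 - e \<le> y" "y \<le> y0 + e" "F s y = 0" by blast
    then show ?case by (intro exI[of _ y]) (simp add: abs_le_iff)
  qed
qed

section \<open>CES technologies\<close>

text \<open>The CES function is homogeneous of degree one, so its marginal products depend only on
  the input ratio \<open>r\<close>. They are written as they occur in the steady-state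
  equation.\<close>

definition ces_mpx :: "real \<Rightarrow> real \<Rightarrow> real \<Rightarrow> real \<Rightarrow> real" where
  "ces_mpx A \<alpha> \<psi> r = \<alpha> * A * r powr (\<psi> - 1) * (\<alpha> * r powr \<psi> + 1 - \<alpha>) powr (1 / \<psi> - 1)"

definition ces_mpy :: "real \<Rightarrow> real \<Rightarrow> real \<Rightarrow> real \<Rightarrow> real" where
  "ces_mpy A \<alpha> \<psi> r = (1 - \<alpha>) * A * (\<alpha> * r powr \<psi> + 1 - \<alpha>) powr (1 / \<psi> - 1)"

lemma ces_bundle_pos:
  fixes \<alpha> r \<psi> :: real
  assumes "0 < \<alpha>" "\<alpha> < 1" "0 < r"
  shows "0 < \<alpha> * r powr \<psi> + 1 - \<alpha>"
proof -
  have "0 < \<alpha> * r powr \<psi>" using assms by simp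
  then show ?thesis using assms by linarith
qed

lemma ces_scale:
  assumes "0 < c" "0 < x" "0 < y" "0 < \<alpha>" "\<alpha> < 1" "\<psi> \<noteq> 0"
  shows "ces A \<alpha> \<psi> (c * x) (c * y) = c * ces A \<alpha> \<psi> x y"
proof -
  have "\<alpha> * (c * x) powr \<psi> + (1 - \<alpha>) * (c * y) powr \<psi>
      = c powr \<psi> * (\<alpha> * x powr \<psi> + (1 - \<alpha>) * y powr \<psi>)"
    using assms by (simp add: powr_mult algebra_simps)
  moreover have "0 < \<alpha> * x powr \<psi> + (1 - \<alpha>) * y powr \<psi>"
    using assms by (intro add_pos_pos) auto
  ultimately show ?thesis
    using assms by (simp add: ces_def powr_mult powr_powr)
qed

lemma ces_bundle_ratio:
  fixes \<alpha> x y \<psi> :: real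
  assumes "0 < x" "0 < y"
  shows "\<alpha> * x powr \<psi> + (1 - \<alpha>) * y powr \<psi> = y powr \<psi> * (\<alpha> * (x / y) powr \<psi> + 1 - \<alpha>)"
  using assms by (simp add: powr_divide field_simps)

lemma DERIV_ces_x:
  assumes "0 < x" "0 < y" "0 < \<alpha>" "\<alpha> < 1" "\<psi> \<noteq> 0"
  shows "((\<lambda>x. ces A \<alpha> \<psi> x y) has_real_derivative ces_mpx A \<alpha> \<psi> (x / y)) (at x)"
proof -
  define r where "r = x / y"
  define P where "P = \<alpha> * r powr \<psi> + 1 - \<alpha>"
  have r: "0 < r" "x = r * y" using assms by (simp_all add: r_def)
  have P: "0 < P" unfolding P_def using assms r by (intro ces_bundle_pos)
  have eq: "\<alpha> * x powr \<psi> + (1 - \<alpha>) * y powr \<psi> = y powr \<psi> * P"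
    unfolding P_def r_def using assms by (intro ces_bundle_ratio)
  have pos: "0 < \<alpha> * x powr \<psi> + (1 - \<alpha>) * y powr \<psi>" unfolding eq using assms P by simp
  have "((\<lambda>x. ces A \<alpha> \<psi> x y) has_real_derivative
      A * (1 / \<psi> * (\<alpha> * x powr \<psi> + (1 - \<alpha>) * y powr \<psi>) powr (1 / \<psi> - 1)
        * (\<alpha> * (\<psi> * x powr (\<psi> - 1))))) (at x)"
    unfolding ces_def using assms pos
    by (auto intro!: derivative_eq_intros)
  \<comment> \<open>The powers of \<open>y\<close> cancel because
    \<open>\<psi> * (1 / \<psi> - 1) = 1 - \<psi>\<close>.\<close>
  moreover have "(y powr \<psi> * P) powr (1 / \<psi> - 1) * x powr (\<psi> - 1)
      = P powr (1 / \<psi> - 1) * r powr (\<psi> - 1)"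
  proof -
    have "\<psi> * (1 / \<psi> - 1) = 1 - \<psi>" using assms by (simp add: field_simps)
    then have "(y powr \<psi> * P) powr (1 / \<psi> - 1) = y powr (1 - \<psi>) * P powr (1 / \<psi> - 1)"
      using assms P by (simp add: powr_mult powr_powr)
    moreover have "x powr (\<psi> - 1) = r powr (\<psi> - 1) * y powr (\<psi> - 1)"
      using assms r by (simp add: powr_mult)
    moreover have "y powr (1 - \<psi>) * y powr (\<psi> - 1) = 1"
      using assms by (simp flip: powr_add)
    ultimately show ?thesis by algebra
  qed
  ultimately show ?thesis
    unfolding ces_mpx_def r_def[symmetric] P_def[symmetric] eq
    using assms by (simp add: mult_ac)
qed

lemma DERIV_ces_y:
  assumes "0 < x" "0 < y" "0 < \<alpha>" "\<alpha> < 1" "\<psi> \<noteq> 0"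
  shows "((\<lambda>y. ces A \<alpha> \<psi> x y) has_real_derivative ces_mpy A \<alpha> \<psi> (x / y)) (at y)"
proof -
  define P where "P = \<alpha> * (x / y) powr \<psi> + 1 - \<alpha>"
  have P: "0 < P" unfolding P_def using assms by (intro ces_bundle_pos) auto
  have eq: "\<alpha> * x powr \<psi> + (1 - \<alpha>) * y powr \<psi> = y powr \<psi> * P"
    unfolding P_def using assms by (intro ces_bundle_ratio)
  have pos: "0 < \<alpha> * x powr \<psi> + (1 - \<alpha>) * y powr \<psi>" unfolding eq using assms P by simp
  have "((\<lambda>y. ces A \<alpha> \<psi> x y) has_real_derivative
      A * (1 / \<psi> * (\<alpha> * x powr \<psi> + (1 - \<alpha>) * y powr \<psi>) powr (1 / \<psi> - 1)
        * ((1 - \<alpha>) * (\<psi> * y powr (\<psi> - 1))))) (at y)"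
    unfolding ces_def using assms pos
    by (auto intro!: derivative_eq_intros)
  moreover have "(y powr \<psi> * P) powr (1 / \<psi> - 1) * y powr (\<psi> - 1) = P powr (1 / \<psi> - 1)"
  proof -
    have "\<psi> * (1 / \<psi> - 1) = 1 - \<psi>" using assms by (simp add: field_simps)
    then have "(y powr \<psi> * P) powr (1 / \<psi> - 1) = y powr (1 - \<psi>) * P powr (1 / \<psi> - 1)"
      using assms P by (simp add: powr_mult powr_powr)
    moreover have "y powr (1 - \<psi>) * y powr (\<psi> - 1) = 1"
      using assms by (simp flip: powr_add)
    ultimately show ?thesis by algebra
  qed
  ultimately show ?thesis
    unfolding ces_mpy_def P_def[symmetric] eq
    using assms by (simp add: mult_ac)
qed

section \<open>Marginal products under the normalization\<close>

lemma norm_alpha_bounds: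
  assumes "0 < x" "0 < m"
  shows "0 < norm_alpha m x \<psi>" "norm_alpha m x \<psi> < 1"
  using assms by (simp_all add: norm_alpha_def add_pos_pos)

lemma norm_A_pos:
  assumes "0 < x" "0 < m" "0 < a"
  shows "0 < norm_A m a x \<psi>"
proof -
  have "0 < x powr (1 - \<psi>) + m" using assms by (simp add: add_pos_pos)
  then have "(x powr (1 - \<psi>) + m) / (x + m) \<noteq> 0" using assms by auto
  then show ?thesis using assms by (simp add: norm_A_def)
qed

text \<open>This is the calibration: at the baseline ratio \<open>x\<close> the second input has
  \<open>m\<close> times the marginal product of the first, for every \<open>\<psi>\<close>.\<close>

lemma norm_alpha_mrs:
  assumes "0 < x" "0 < m"
  shows "norm_alpha m x \<psi> / (1 - norm_alpha m x \<psi>) = x powr (1 - \<psi>) / m"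
proof -
  have "0 < x powr (1 - \<psi>) + m" using assms by (simp add: add_pos_pos)
  moreover from this have "1 - norm_alpha m x \<psi> = m / (x powr (1 - \<psi>) + m)"
    by (simp add: norm_alpha_def field_simps)
  ultimately show ?thesis using assms by (simp add: norm_alpha_def)
qed

text \<open>Here \<open>t\<close> is the logarithmic deviation of the input ratio from its baseline
  \<open>x\<close>. The first factor is the bundle at \<open>t = 0\<close>; the remaining mix equals
  \<open>1\<close> there and has a weight free of \<open>\<psi>\<close>.\<close>

lemma norm_bundle:
  assumes x: "0 < x" and m: "0 < m"
  shows "norm_alpha m x \<psi> * (x * exp t) powr \<psi> + 1 - norm_alpha m x \<psi>
    = (x + m) / (x powr (1 - \<psi>) + m) * mix (m / (x + m)) (- \<psi> * t)"
proof -
  define Q where "Q = x powr (1 - \<psi>)"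
  have Q: "0 < Q + m" using assms by (simp add: Q_def add_pos_pos)
  have "x powr \<psi> * Q = x" unfolding Q_def using x by (simp flip: powr_add)
  then have "Q * (x * exp t) powr \<psi> = x * exp (\<psi> * t)"
    using x by (simp add: powr_mult exp_powr_real mult_ac)
  moreover have "norm_alpha m x \<psi> * (x * exp t) powr \<psi> + 1 - norm_alpha m x \<psi>
      = (Q * (x * exp t) powr \<psi> + m) / (Q + m)"
    using Q by (simp add: norm_alpha_def Q_def[symmetric] divide_simps)
  moreover have "mix (m / (x + m)) (- \<psi> * t) = (x * exp (\<psi> * t) + m) / (x + m)"
  proof -
    have "1 - m / (x + m) = x / (x + m)" using assms by (simp add: field_simps)
    then show ?thesis by (simp add: mix_def add_divide_distrib)
  qed
  ultimately show ?thesis using assms by (simp add: Q_def[symmetric])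
qed

text \<open>Exchanges the two numbers being averaged, so that \<open>norm_mpx\<close> can use the
  weight \<open>x / (x + m)\<close> in place of \<open>m / (x + m)\<close>.\<close>

lemma mix_reflect: "mix (1 - b) (- z) = exp z * mix b z"
  by (simp add: mix_def algebra_simps flip: exp_add)

lemma norm_mpy:
  assumes x: "0 < x" and m: "0 < m" and "\<psi> \<noteq> 0"
  shows "ces_mpy (norm_A m a x \<psi>) (norm_alpha m x \<psi>) \<psi> (x * exp t)
    = m * a / (x + m) * mix (m / (x + m)) (- \<psi> * t) powr (1 / \<psi> - 1)"
proof -
  define Q where "Q = x powr (1 - \<psi>)"
  define R where "R = (Q + m) / (x + m)"
  define M where "M = mix (m / (x + m)) (- \<psi> * t)"
  have Q: "0 < Q + m" using assms by (simp add: Q_def add_pos_pos)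
  have R: "0 < R" using Q x m by (simp add: R_def)
  have M: "0 < M" unfolding M_def using x m by (intro mix_pos) auto
  have P: "norm_alpha m x \<psi> * (x * exp t) powr \<psi> + 1 - norm_alpha m x \<psi> = inverse R * M"
    unfolding M_def R_def Q_def norm_bundle[OF x m] by simp
  have A: "norm_A m a x \<psi> = a * R powr (1 / \<psi>)"
    by (simp add: norm_A_def R_def Q_def)
  have \<alpha>: "1 - norm_alpha m x \<psi> = m / (Q + m)"
    using Q by (simp add: norm_alpha_def Q_def[symmetric] field_simps)
  \<comment> \<open>\<open>R\<close> is the reciprocal of the baseline bundle. Its powers in
    \<open>norm_A\<close> and in the bundle combine to \<open>R\<close> itself, which turns
    \<open>m / (Q + m)\<close> into \<open>m / (x + m)\<close>.\<close>
  have "inverse R powr (1 / \<psi> - 1) = R powr (1 - 1 / \<psi>)"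
    using R powr_minus[of R "1 / \<psi> - 1"] by (simp add: inverse_powr)
  then have R_powr: "R powr (1 / \<psi>) * inverse R powr (1 / \<psi> - 1) = R"
    using R by (simp flip: powr_add)
  have "ces_mpy (norm_A m a x \<psi>) (norm_alpha m x \<psi>) \<psi> (x * exp t)
      = m / (Q + m) * a * (R powr (1 / \<psi>) * inverse R powr (1 / \<psi> - 1)) * M powr (1 / \<psi> - 1)"
    unfolding ces_mpy_def P A \<alpha> using R M by (subst powr_mult) (auto simp: mult_ac)
  also have "\<dots> = m * a / (x + m) * M powr (1 / \<psi> - 1)"
    unfolding R_powr using Q by (simp add: R_def)
  finally show ?thesis unfolding M_def .
qed

lemma ces_mpx_eq_mpy:
  assumes "0 < \<alpha>" "\<alpha> < 1"
  shows "ces_mpx A \<alpha> \<psi> r = \<alpha> / (1 - \<alpha>) * r powr (\<psi> - 1) * ces_mpy A \<alpha> \<psi> r"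
  using assms by (simp add: ces_mpx_def ces_mpy_def)

lemma ces_mpy_pos:
  assumes "0 < \<alpha>" "\<alpha> < 1" "0 < A" "0 < r"
  shows "0 < ces_mpy A \<alpha> \<psi> r"
  using ces_bundle_pos[of \<alpha> r \<psi>] assms by (simp add: ces_mpy_def)

lemma norm_mpx:
  assumes x: "0 < x" and m: "0 < m" and "\<psi> \<noteq> 0"
  shows "ces_mpx (norm_A m a x \<psi>) (norm_alpha m x \<psi>) \<psi> (x * exp t)
    = a / (x + m) * mix (x / (x + m)) (\<psi> * t) powr (1 / \<psi> - 1)"
proof -
  define M where "M = mix (x / (x + m)) (\<psi> * t)"
  have M: "0 < M" unfolding M_def using x m by (intro mix_pos) auto
  have "m / (x + m) = 1 - x / (x + m)" using x m by (simp add: field_simps)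
  then have "mix (m / (x + m)) (- \<psi> * t) = exp (\<psi> * t) * M"
    using mix_reflect[of "x / (x + m)" "\<psi> * t"] by (simp add: M_def)
  moreover have "(exp (\<psi> * t) * M) powr (1 / \<psi> - 1) = exp ((1 - \<psi>) * t) * M powr (1 / \<psi> - 1)"
    using M \<open>\<psi> \<noteq> 0\<close> by (simp add: powr_mult exp_powr_real field_simps)
  moreover have "x powr (1 - \<psi>) * (x * exp t) powr (\<psi> - 1) * exp ((1 - \<psi>) * t) = 1"
    using x by (simp add: powr_mult exp_powr_real flip: powr_add exp_add)
      (simp add: algebra_simps powr_add[symmetric] exp_add[symmetric])
  ultimately show ?thesis
    unfolding ces_mpx_eq_mpy[OF norm_alpha_bounds[OF x m]] norm_alpha_mrs[OF x m]
      norm_mpy[OF x m \<open>\<psi> \<noteq> 0\<close>] M_def[symmetric] using m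
    by (simp add: mult_ac)
qed

section \<open>Comparative statics of the steady state\<close>

text \<open>The reason for dividing the logarithmic deviation by \<open>\<sigma>\<close>: with
  \<open>t = \<sigma> * y\<close> the argument \<open>psi \<sigma> * t\<close> is
  \<open>(\<sigma> - 1) * y\<close> and the outer exponent is \<open>1 / (\<sigma> - 1)\<close>, so
  marginal products become power means of order \<open>\<sigma> - 1\<close>.\<close>

lemma psi_simps:
  assumes "0 < \<sigma>" "\<sigma> \<noteq> 1"
  shows "psi \<sigma> \<noteq> 0" "1 - psi \<sigma> = 1 / \<sigma>" "1 / psi \<sigma> - 1 = 1 / (\<sigma> - 1)"
    "psi \<sigma> * t = (\<sigma> - 1) * (t / \<sigma>)"
  using assms by (simp_all add: psi_def field_simps)

section \<open>The steady-state equation in logarithmic form\<close>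

locale normalized_model =
  fixes E :: environment and B :: baseline and \<sigma>2 :: real
  assumes eps_gt_1: "1 < eps E" and baseline: "valid_baseline B" and \<sigma>2: "0 < \<sigma>2" "\<sigma>2 \<noteq> 1"
begin

text \<open>\<open>W\<close> and \<open>X\<close> are the baseline input ratios of goods and
  education. \<open>C1\<close> and \<open>C2\<close> are the baseline marginal products of capital
  in goods and of human capital in education; \<open>b1\<close> and \<open>b2\<close> are the
  corresponding baseline factor shares.\<close>

definition W where "W = wbar B"
definition X where "X = wbar B / taubar B"
definition m where "m = mrs B"
definition C1 where "C1 = y1bar B / (hbar B * ubar B) / (W + m)"
definition C2 where "C2 = m * (y2bar B / (hbar B * (1 - ubar B))) / (X + m)"
definition b1 where "b1 = W / (W + m)"
definition b2 where "b2 = m / (X + m)"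

text \<open>The marginal products of capital in the goods sector and of human capital in education, as
  functions of \<open>y = ln (w / W) / \<sigma>1\<close>. Equality of the marginal rates of substitution in both sectors
  makes the input ratio in education \<open>X * exp (\<sigma>2 * y)\<close>.\<close>

definition mpk where "mpk \<sigma> y = C1 * pmean b1 (\<sigma> - 1) y"
definition mph where "mph y = C2 * pmean b2 (\<sigma>2 - 1) (- y)"
definition excess where "excess \<sigma> y = mpk \<sigma> y - mph y - (dk E - dh E)"

lemma pos: "0 < W" "0 < X" "0 < m" "0 < C1" "0 < C2"
  using baseline
  by (auto simp: W_def X_def m_def C1_def C2_def valid_baseline_def wbar_def taubar_def
      intro!: mult_pos_pos divide_pos_pos add_pos_pos)

lemma shares: "0 < b1" "b1 < 1" "0 < b2" "b2 < 1"
  using pos by (auto simp: b1_def b2_def)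

lemma mpk_pos: "0 < mpk \<sigma> y"
  using pos pmean_pos[OF shares(1,2)] by (simp add: mpk_def)

lemma mpk_strict_antimono: "\<sigma> \<noteq> 1 \<Longrightarrow> y < y' \<Longrightarrow> mpk \<sigma> y' < mpk \<sigma> y"
  using pos pmean_strict_antimono[OF shares(1,2)] by (simp add: mpk_def)

lemma mph_strict_mono: "y < y' \<Longrightarrow> mph y < mph y'"
  using pos pmean_strict_antimono[OF shares(3,4)] \<sigma>2 by (simp add: mph_def)

lemma excess_strict_antimono: "\<sigma> \<noteq> 1 \<Longrightarrow> y < y' \<Longrightarrow> excess \<sigma> y' < excess \<sigma> y"
  using mpk_strict_antimono[of \<sigma> y y'] mph_strict_mono[of y y'] by (simp add: excess_def)

lemma excess_inj: "\<sigma> \<noteq> 1 \<Longrightarrow> excess \<sigma> y = excess \<sigma> y' \<Longrightarrow> y = y'"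
  using excess_strict_antimono[of \<sigma>] by (metis less_irrefl linorder_neqE)

lemma normalized_simps:
  "A1 (normalized B \<sigma> \<sigma>2) = norm_A m (y1bar B / (hbar B * ubar B)) W (psi \<sigma>)"
  "alpha1 (normalized B \<sigma> \<sigma>2) = norm_alpha m W (psi \<sigma>)"
  "psi1 (normalized B \<sigma> \<sigma>2) = psi \<sigma>"
  "A2 (normalized B \<sigma> \<sigma>2) = norm_A m (y2bar B / (hbar B * (1 - ubar B))) X (psi \<sigma>2)"
  "alpha2 (normalized B \<sigma> \<sigma>2) = norm_alpha m X (psi \<sigma>2)"
  "psi2 (normalized B \<sigma> \<sigma>2) = psi \<sigma>2"
  by (simp_all add: normalized_def W_def X_def m_def)

lemma goods_mpx:
  assumes "0 < \<sigma>" "\<sigma> \<noteq> 1" and T: "T = normalized B \<sigma> \<sigma>2"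
  shows "ces_mpx (A1 T) (alpha1 T) (psi1 T) (W * exp (\<sigma> * y)) = mpk \<sigma> y"
  unfolding T normalized_simps norm_mpx[OF pos(1,3) psi_simps(1)[OF assms(1,2)]]
    psi_simps(3,4)[OF assms(1,2)] mpk_def C1_def b1_def pmean_def
  using assms by simp

lemma education_mpy:
  assumes T: "T = normalized B \<sigma> \<sigma>2"
  shows "ces_mpy (A2 T) (alpha2 T) (psi2 T) (X * exp (\<sigma>2 * y)) = mph y"
proof -
  have eq: "- psi \<sigma>2 * (\<sigma>2 * y) = (\<sigma>2 - 1) * - y"
    using psi_simps(4)[OF \<sigma>2, of "\<sigma>2 * y"] \<sigma>2 by simp
  show ?thesis
    unfolding T normalized_simps norm_mpy[OF pos(2,3) psi_simps(1)[OF \<sigma>2]] eq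
      psi_simps(3)[OF \<sigma>2] mph_def C2_def b2_def pmean_def by simp
qed

text \<open>The powers of \<open>theta T\<close> and \<open>w\<close> in \<open>P2\<close> multiply
  to \<open>z powr psi2 T\<close>, where \<open>z\<close> is the education input ratio that equates
  the marginal rates of substitution. The common \<open>m\<close> cancels in \<open>theta T\<close>,
  which leaves \<open>z = X * exp (\<sigma>2 * y)\<close>.\<close>

lemma P2_normalized:
  assumes \<sigma>: "0 < \<sigma>" and T: "T = normalized B \<sigma> \<sigma>2"
  shows "P2 T (W * exp (\<sigma> * y)) = alpha2 T * (X * exp (\<sigma>2 * y)) powr psi2 T + 1 - alpha2 T"
proof -
  define p q where "p = psi \<sigma>" and "q = psi \<sigma>2"
  have p: "1 - p = 1 / \<sigma>" using \<sigma> by (simp add: p_def psi_def field_simps)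
  have q: "1 - q = 1 / \<sigma>2" using \<sigma>2 by (simp add: q_def psi_def field_simps)
  have "theta T = (alpha1 T / (1 - alpha1 T)) / (alpha2 T / (1 - alpha2 T))"
    by (simp add: theta_def)
  also have "\<dots> = W powr (1 - p) / X powr (1 - q)"
    unfolding T normalized_simps norm_alpha_mrs[OF pos(1,3)] norm_alpha_mrs[OF pos(2,3)]
    using pos by (simp add: p_def q_def)
  finally have "ln (theta T) = ln W / \<sigma> - ln X / \<sigma>2"
    using pos p q by (simp add: ln_div ln_powr)
  moreover have "0 < theta T"
    using norm_alpha_bounds[OF pos(1,3)] norm_alpha_bounds[OF pos(2,3)]
    unfolding theta_def T normalized_simps by simp
  ultimately have "theta T powr (- (q / (1 - q))) * (W * exp (\<sigma> * y)) powr (q * (1 - p) / (1 - q))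
      = exp (- (q * \<sigma>2) * (ln W / \<sigma> - ln X / \<sigma>2) + q * \<sigma>2 / \<sigma> * (ln W + \<sigma> * y))"
    unfolding p q using pos by (simp add: powr_def ln_mult flip: exp_add)
  also have "\<dots> = (X * exp (\<sigma>2 * y)) powr q"
    using pos \<sigma> \<sigma>2 by (simp add: powr_def ln_mult field_simps)
  finally show ?thesis
    unfolding P2_def T normalized_simps p_def q_def by (simp add: mult.assoc)
qed

lemma steady_state_iff:
  assumes "0 < \<sigma>" "\<sigma> \<noteq> 1"
  shows "steady_state E (normalized B \<sigma> \<sigma>2) (W * exp (\<sigma> * y)) \<longleftrightarrow> excess \<sigma> y = 0"
proof -
  define T where "T = normalized B \<sigma> \<sigma>2"
  show ?thesis
    unfolding T_def[symmetric] steady_state_def excess_def goods_mpx[OF assms T_def, symmetric]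
      education_mpy[OF T_def, symmetric] ces_mpx_def ces_mpy_def
      P1_def P2_normalized[OF assms(1) T_def]
    using pos by simp
qed

text \<open>Positivity is part of \<open>steady_state\<close>, so passing to \<open>y\<close> loses
  no solution.\<close>

lemma steady_state_log:
  assumes "steady_state E T w" "0 < \<sigma>"
  shows "w = W * exp (\<sigma> * (ln (w / W) / \<sigma>))"
  using assms pos by (simp add: steady_state_def)

lemma elasticities_iff:
  "\<sigma> \<in> elasticities E B \<sigma>2 \<longleftrightarrow> 0 < \<sigma> \<and> \<sigma> \<noteq> 1 \<and> (\<exists>y. excess \<sigma> y = 0)"
proof -
  have "(\<exists>w. steady_state E (normalized B \<sigma> \<sigma>2) w) \<longleftrightarrow> (\<exists>y. excess \<sigma> y = 0)"
    if \<sigma>: "0 < \<sigma>" "\<sigma> \<noteq> 1"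
  proof
    assume "\<exists>w. steady_state E (normalized B \<sigma> \<sigma>2) w"
    then obtain w where w: "steady_state E (normalized B \<sigma> \<sigma>2) w" ..
    then have "excess \<sigma> (ln (w / W) / \<sigma>) = 0"
      by (subst (asm) steady_state_log[OF w \<sigma>(1)]) (simp only: steady_state_iff[OF \<sigma>])
    then show "\<exists>y. excess \<sigma> y = 0" ..
  next
    assume "\<exists>y. excess \<sigma> y = 0"
    then show "\<exists>w. steady_state E (normalized B \<sigma> \<sigma>2) w"
      using steady_state_iff[OF \<sigma>] by blast
  qed
  then show ?thesis unfolding elasticities_def by blast
qed

lemma elasticities_bounds:
  assumes "\<sigma> \<in> elasticities E B \<sigma>2"
  shows "0 < \<sigma>" "\<sigma> \<noteq> 1"
  using assms by (simp_all add: elasticities_def)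

definition y_star where "y_star \<sigma> = (THE y. excess \<sigma> y = 0)"

lemma y_star_eqI:
  assumes "\<sigma> \<noteq> 1" "excess \<sigma> y = 0"
  shows "y_star \<sigma> = y"
  unfolding y_star_def
proof (rule the_equality)
  fix z assume "excess \<sigma> z = 0"
  with assms(2) have "excess \<sigma> z = excess \<sigma> y" by simp
  with assms(1) show "z = y" by (rule excess_inj)
qed (rule assms)

lemma excess_y_star:
  assumes "\<sigma> \<in> elasticities E B \<sigma>2"
  shows "excess \<sigma> (y_star \<sigma>) = 0"
proof -
  obtain y where "excess \<sigma> y = 0" using assms unfolding elasticities_iff by blast
  with y_star_eqI[OF elasticities_bounds(2)[OF assms] this] show ?thesis by (simp only:)
qed

lemma w_star_eq:
  assumes "\<sigma> \<in> elasticities E B \<sigma>2"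
  shows "w_star E B \<sigma>2 \<sigma> = W * exp (\<sigma> * y_star \<sigma>)"
  unfolding w_star_def steady_w_def
proof (rule the_equality)
  note \<sigma> = elasticities_bounds[OF assms]
  show "steady_state E (normalized B \<sigma> \<sigma>2) (W * exp (\<sigma> * y_star \<sigma>))"
    unfolding steady_state_iff[OF \<sigma>] by (rule excess_y_star[OF assms])
  fix w assume w: "steady_state E (normalized B \<sigma> \<sigma>2) w"
  define y where "y = ln (w / W) / \<sigma>"
  have w_eq: "w = W * exp (\<sigma> * y)" unfolding y_def by (rule steady_state_log[OF w \<sigma>(1)])
  have "excess \<sigma> y = 0" using w unfolding w_eq steady_state_iff[OF \<sigma>] .
  then have "y_star \<sigma> = y" by (rule y_star_eqI[OF \<sigma>(2)])
  then show "w = W * exp (\<sigma> * y_star \<sigma>)" using w_eq by (simp only:)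
qed

lemma w_star_gt_iff:
  assumes "\<sigma> \<in> elasticities E B \<sigma>2"
  shows "w_star E B \<sigma>2 \<sigma> > wbar B \<longleftrightarrow> 0 < y_star \<sigma>"
proof -
  have "0 < \<sigma>" using elasticities_bounds[OF assms] by simp
  then show ?thesis
    unfolding w_star_eq[OF assms] W_def[symmetric] using pos by (simp add: zero_less_mult_iff)
qed

lemma r_star_eq:
  assumes "\<sigma> \<in> elasticities E B \<sigma>2"
  shows "r_star E B \<sigma>2 \<sigma> = 1 / eps E * (mpk \<sigma> (y_star \<sigma>) - rho E - dk E)"
proof -
  note \<sigma> = elasticities_bounds[OF assms]
  show ?thesis
    unfolding r_star_def steady_growth_def Let_def w_star_def[symmetric] w_star_eq[OF assms]
    using goods_mpx[OF \<sigma> refl, of "y_star \<sigma>"] by (simp add: ces_mpx_def)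
qed

text \<open>In this form the elasticity enters only through \<open>y_star\<close>, so the growth
  rate moves in the same direction as \<open>y_star\<close>.\<close>

lemma r_star_eq_mph:
  assumes "\<sigma> \<in> elasticities E B \<sigma>2"
  shows "r_star E B \<sigma>2 \<sigma> = 1 / eps E * (mph (y_star \<sigma>) - rho E - dh E)"
proof -
  have "mpk \<sigma> (y_star \<sigma>) = mph (y_star \<sigma>) + dk E - dh E"
    using excess_y_star[OF assms] by (simp add: excess_def)
  then show ?thesis by (simp add: r_star_eq[OF assms])
qed

section \<open>The physical-capital share and the share form of the growth rate\<close>

definition share where "share z = W * exp z / (W * exp z + m)"

lemma k_share_eq: "k_share B \<sigma> (W * exp t) = share (psi \<sigma> * t)"
proof -
  have "W powr (1 - psi \<sigma>) * (W * exp t) powr psi \<sigma> = W * exp (psi \<sigma> * t)"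
  proof -
    have "W powr (1 - psi \<sigma>) * W powr psi \<sigma> = W" using pos by (simp flip: powr_add)
    then show ?thesis using pos by (simp add: powr_mult exp_powr_real mult_ac)
  qed
  then show ?thesis by (simp add: k_share_def share_def flip: W_def m_def)
qed

lemma k_share_star_eq:
  assumes "\<sigma> \<in> elasticities E B \<sigma>2"
  shows "k_share_star E B \<sigma>2 \<sigma> = share ((\<sigma> - 1) * y_star \<sigma>)"
proof -
  note \<sigma> = elasticities_bounds[OF assms]
  show ?thesis
    unfolding k_share_star_def w_star_eq[OF assms] k_share_eq psi_simps(4)[OF \<sigma>] using \<sigma> by simp
qed

text \<open>Baseline share over current share is the base of the power mean in \<open>mpk\<close>;
  this turns the growth rate into its share form.\<close>

lemma b1_div_share: "b1 / share z = mix b1 z"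
proof -
  have "0 < W + m" "0 < W * exp z + m" using pos by (simp_all add: add_pos_pos)
  then have n: "W + m \<noteq> 0" "W * exp z + m \<noteq> 0" "W * exp z \<noteq> 0" using pos by auto
  have "1 - b1 = m / (W + m)" using n by (simp add: b1_def diff_divide_eq_iff)
  then have "mix b1 z = (W + m / exp z) / (W + m)"
    by (simp add: mix_def b1_def distrib_right exp_minus divide_inverse)
  also have "\<dots> = W / (W + m) * ((W * exp z + m) / (W * exp z))"
  proof -
    have "W + m / exp z = (W * exp z + m) / exp z" by (simp add: field_simps)
    then show ?thesis using n by simp
  qed
  finally show ?thesis using n by (simp add: b1_def share_def)
qed

lemma r_star_share:
  assumes "\<sigma> \<in> elasticities E B \<sigma>2"
  shows "r_star E B \<sigma>2 \<sigma> = 1 / eps E * (y1bar B / (kbar B * vbar B) * k_share_bar B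
            * (k_share_bar B / k_share_star E B \<sigma>2 \<sigma>) powr ((1 - psi \<sigma>) / psi \<sigma>)
            - rho E - dk E)"
proof -
  note \<sigma> = elasticities_bounds[OF assms]
  have bar: "k_share_bar B = b1" by (simp add: k_share_bar_def b1_def W_def m_def)
  have exponent: "(1 - psi \<sigma>) / psi \<sigma> = 1 / (\<sigma> - 1)"
    unfolding diff_divide_distrib divide_self[OF psi_simps(1)[OF \<sigma>]] by (rule psi_simps(3)[OF \<sigma>])
  have C1: "y1bar B / (kbar B * vbar B) * b1 = C1"
  proof -
    have "y1bar B / (kbar B * vbar B) * W = y1bar B / (hbar B * ubar B)"
      using baseline by (simp add: valid_baseline_def W_def wbar_def)
    then show ?thesis unfolding C1_def b1_def by (simp only: times_divide_eq_right)
  qed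
  show ?thesis
    unfolding r_star_eq[OF assms] k_share_star_eq[OF assms] bar exponent C1 b1_div_share
      mpk_def pmean_def by (rule refl)
qed

lemma DERIV_share:
  assumes "(z has_real_derivative D) (at x)"
  shows "((\<lambda>x. share (z x)) has_real_derivative W * exp (z x) * m / (W * exp (z x) + m)\<^sup>2 * D) (at x)"
proof -
  have "0 < W * exp (z x) + m" using pos by (simp add: add_pos_pos)
  then have n: "W * exp (z x) + m \<noteq> 0" by simp
  have num: "((\<lambda>x. W * exp (z x)) has_real_derivative W * (exp (z x) * D)) (at x)"
    by (intro DERIV_cmult DERIV_fun_exp assms)
  have den: "((\<lambda>x. W * exp (z x) + m) has_real_derivative W * (exp (z x) * D) + 0) (at x)"
    by (intro DERIV_add num DERIV_const)
  show ?thesis unfolding share_def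
    by (rule DERIV_cong[OF DERIV_divide[OF num den n]]) (simp add: power2_eq_square algebra_simps)
qed

text \<open>The chain rule multiplies \<open>D\<close> by a positive number, and uniqueness of
  derivatives gives the converse. Agreement is asked for only near \<open>x\<close> because
  \<open>k_share_star\<close> is controlled only where a steady state exists.\<close>

lemma increasing_at_share_iff:
  assumes z: "(z has_real_derivative D) (at x)" and f: "\<forall>\<^sub>F y in nhds x. f y = share (z y)"
  shows "increasing_at f x \<longleftrightarrow> 0 < D"
proof -
  define c where "c = W * exp (z x) * m / (W * exp (z x) + m)\<^sup>2"
  have "0 < W * exp (z x) + m" using pos by (simp add: add_pos_pos)
  then have "0 < c" using pos by (simp add: c_def)
  have "(f has_real_derivative c * D) (at x)"
    unfolding c_def DERIV_cong_ev[OF refl f refl] by (rule DERIV_share[OF z])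
  then have "increasing_at f x \<longleftrightarrow> 0 < c * D"
    unfolding increasing_at_def by (metis DERIV_unique)
  then show ?thesis using \<open>0 < c\<close> by (simp add: zero_less_mult_iff)
qed

section \<open>Implicit differentiation of the steady state in the elasticity\<close>

definition mpk' where
  "mpk' \<sigma> y = - (C1 * (tilt b1 ((\<sigma> - 1) * y) * pmean b1 (\<sigma> - 1) y))"
definition mph' where
  "mph' y = C2 * (tilt b2 ((\<sigma>2 - 1) * - y) * pmean b2 (\<sigma>2 - 1) (- y))"
definition mpk_elast where
  "mpk_elast \<sigma> y = C1 * (- pmean b1 (\<sigma> - 1) y * (ln (mix b1 ((\<sigma> - 1) * y))
     + tilt b1 ((\<sigma> - 1) * y) * ((\<sigma> - 1) * y)) / (\<sigma> - 1)\<^sup>2)"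

lemma DERIV_mpk: "\<sigma> \<noteq> 1 \<Longrightarrow> (mpk \<sigma> has_real_derivative mpk' \<sigma> y) (at y)"
  unfolding mpk_def[abs_def] mpk'_def
  using DERIV_cmult[OF DERIV_pmean[OF shares(1,2)], of "\<sigma> - 1" C1 y] by simp

lemma DERIV_mph: "(mph has_real_derivative mph' y) (at y)"
proof -
  have "((\<lambda>y. pmean b2 (\<sigma>2 - 1) (- y)) has_real_derivative
      - (tilt b2 ((\<sigma>2 - 1) * - y) * pmean b2 (\<sigma>2 - 1) (- y)) * - 1) (at y)"
    using \<sigma>2 by (intro DERIV_chain2[OF DERIV_pmean[OF shares(3,4)]] DERIV_minus DERIV_ident) auto
  from DERIV_cmult[OF this, of C2] show ?thesis
    unfolding mph_def[abs_def] mph'_def by simp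
qed

lemma DERIV_excess: "\<sigma> \<noteq> 1 \<Longrightarrow> (excess \<sigma> has_real_derivative mpk' \<sigma> y - mph' y) (at y)"
  unfolding excess_def[abs_def]
  using DERIV_diff[OF DERIV_diff[OF DERIV_mpk DERIV_mph] DERIV_const[of "dk E - dh E"]] by simp

lemma DERIV_excess_elast:
  assumes "\<sigma> \<noteq> 1"
  shows "((\<lambda>\<sigma>. excess \<sigma> y) has_real_derivative mpk_elast \<sigma> y) (at \<sigma>)"
proof -
  have "((\<lambda>\<sigma>. pmean b1 (\<sigma> - 1) y) has_real_derivative (- pmean b1 (\<sigma> - 1) y * (ln (mix b1 ((\<sigma> - 1) * y))
     + tilt b1 ((\<sigma> - 1) * y) * ((\<sigma> - 1) * y)) / (\<sigma> - 1)\<^sup>2) * 1) (at \<sigma>)"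
    using assms
    by (intro DERIV_chain2[OF DERIV_pmean_exponent[OF shares(1,2)]]) (auto intro!: derivative_eq_intros)
  from DERIV_cmult[OF this, of C1] show ?thesis
    using DERIV_diff[OF DERIV_diff[OF _ DERIV_const[of "mph y"]] DERIV_const[of "dk E - dh E"]]
    unfolding excess_def mpk_def mpk_elast_def by fastforce
qed

lemma isCont_excess':
  assumes "\<sigma> \<noteq> 1"
  shows "isCont (\<lambda>p. mpk' (fst p) (snd p) - mph' (snd p)) (\<sigma>, y)"
proof -
  have c1: "isCont (\<lambda>p. tilt b1 ((fst p - 1) * snd p) * pmean b1 (fst p - 1) (snd p)) (\<sigma>, y)"
    by (rule isCont_tilt_pmean[OF shares(1,2)]) (use assms in \<open>auto intro!: continuous_intros\<close>)
  have c2: "isCont (\<lambda>p. tilt b2 ((\<sigma>2 - 1) * - snd p) * pmean b2 (\<sigma>2 - 1) (- snd p)) (\<sigma>, y)"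
    by (rule isCont_tilt_pmean[OF shares(3,4)]) (use \<sigma>2 in \<open>auto intro!: continuous_intros\<close>)
  show ?thesis
    unfolding mpk'_def mph'_def
    by (rule continuous_diff[OF continuous_minus[OF continuous_mult[OF continuous_const c1]]
          continuous_mult[OF continuous_const c2]])
qed

lemma mpk'_neg: "mpk' \<sigma> y < 0"
  using pos(4) tilt_bounds[OF shares(1,2)] pmean_pos[OF shares(1,2)] by (simp add: mpk'_def)

lemma mph'_pos: "0 < mph' y"
  using pos(5) tilt_bounds[OF shares(3,4)] pmean_pos[OF shares(3,4)] by (simp add: mph'_def)

lemma mpk_elast_pos: "\<sigma> \<noteq> 1 \<Longrightarrow> y \<noteq> 0 \<Longrightarrow> 0 < mpk_elast \<sigma> y"
  unfolding mpk_elast_def using DERIV_pmean_exponent_pos[OF shares(1,2), of "\<sigma> - 1" y] pos(4)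
  by (intro mult_pos_pos) auto

text \<open>Existence of a steady state is an open condition and \<open>y_star\<close> is
  continuous: \<open>eventually_zero_near\<close> gives a zero close to the old one, and uniqueness
  identifies it with \<open>y_star\<close>.\<close>

lemma eventually_elasticities:
  assumes "\<sigma> \<in> elasticities E B \<sigma>2" "0 < e"
  shows "\<forall>\<^sub>F s in nhds \<sigma>. s \<in> elasticities E B \<sigma>2 \<and> \<bar>y_star s - y_star \<sigma>\<bar> \<le> e"
proof -
  note \<sigma> = elasticities_bounds[OF assms(1)]
  have ev: "\<forall>\<^sub>F s in nhds \<sigma>. s \<in> {0<..} - {1}"
    using \<sigma> by (intro eventually_nhds_in_open open_Diff) auto
  have "\<forall>\<^sub>F s in nhds \<sigma>. \<exists>y. \<bar>y - y_star \<sigma>\<bar> \<le> e \<and> excess s y = 0"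
  proof (rule eventually_zero_near)
    show "isCont (\<lambda>s. excess s y) \<sigma>" for y
      using DERIV_isCont[OF DERIV_excess_elast] \<sigma> by blast
    show "\<forall>\<^sub>F s in nhds \<sigma>. \<forall>y. isCont (excess s) y"
      using ev by eventually_elim (use DERIV_isCont[OF DERIV_excess] in blast)
  qed (use excess_strict_antimono \<sigma> excess_y_star assms in auto)
  then show ?thesis using ev
    by eventually_elim (use y_star_eqI elasticities_iff in auto)
qed

lemma DERIV_y_star:
  assumes "\<sigma> \<in> elasticities E B \<sigma>2"
  shows "(y_star has_real_derivative
    mpk_elast \<sigma> (y_star \<sigma>) / (mph' (y_star \<sigma>) - mpk' \<sigma> (y_star \<sigma>))) (at \<sigma>)"
proof -
  note \<sigma> = elasticities_bounds[OF assms]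
  have ev: "\<forall>\<^sub>F s in at \<sigma>. s \<in> elasticities E B \<sigma>2"
    using eventually_elasticities[OF assms, of 1]
    by (auto simp: eventually_at_filter elim: eventually_mono)
  have "(y_star has_real_derivative
    - mpk_elast \<sigma> (y_star \<sigma>) / (mpk' \<sigma> (y_star \<sigma>) - mph' (y_star \<sigma>))) (at \<sigma>)"
  proof (rule DERIV_implicit[where F = excess and F' = "\<lambda>s y. mpk' s y - mph' y"])
    show "((\<lambda>s. excess s (y_star \<sigma>)) has_real_derivative mpk_elast \<sigma> (y_star \<sigma>)) (at \<sigma>)"
      using \<sigma> by (intro DERIV_excess_elast)
    show "\<forall>\<^sub>F s in at \<sigma>. \<forall>y. (excess s has_real_derivative mpk' s y - mph' y) (at y)"
      using ev by eventually_elim (use DERIV_excess elasticities_iff in blast)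
    show "isCont (\<lambda>p. mpk' (fst p) (snd p) - mph' (snd p)) (\<sigma>, y_star \<sigma>)"
      using \<sigma> by (intro isCont_excess')
    show "mpk' \<sigma> (y_star \<sigma>) - mph' (y_star \<sigma>) \<noteq> 0"
      using mpk'_neg[of \<sigma> "y_star \<sigma>"] mph'_pos[of "y_star \<sigma>"] by linarith
    show "\<forall>\<^sub>F s in at \<sigma>. excess s (y_star s) = excess \<sigma> (y_star \<sigma>)"
      using ev by eventually_elim (simp add: excess_y_star assms)
    show "isCont y_star \<sigma>"
      unfolding isCont_def
    proof (rule tendstoI)
      fix e :: real assume "0 < e"
      with eventually_elasticities[OF assms, of "e / 2"]
      have "\<forall>\<^sub>F s in nhds \<sigma>. dist (y_star s) (y_star \<sigma>) < e"
        by (auto simp: dist_real_def elim!: eventually_mono)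
      then show "\<forall>\<^sub>F s in at \<sigma>. dist (y_star s) (y_star \<sigma>) < e"
        by (auto simp: eventually_at_filter elim: eventually_mono)
    qed
  qed
  then show ?thesis by (metis minus_diff_eq minus_divide_divide minus_minus)
qed

text \<open>At fixed \<open>y\<close> a higher elasticity raises the power mean in
  \<open>mpk\<close>, so the zero of \<open>excess\<close> moves up and \<open>mph\<close> with it.
  At \<open>y = 0\<close> the two averaged numbers coincide and \<open>mpk_elast\<close> vanishes,
  hence the assumption.\<close>

lemma increasing_at_r_star:
  assumes el: "\<sigma> \<in> elasticities E B \<sigma>2" and "y_star \<sigma> \<noteq> 0"
  shows "increasing_at (r_star E B \<sigma>2) \<sigma>"
proof -
  define D where "D = mpk_elast \<sigma> (y_star \<sigma>) / (mph' (y_star \<sigma>) - mpk' \<sigma> (y_star \<sigma>))"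
  have "\<sigma> \<noteq> 1" using elasticities_bounds[OF el] by simp
  then have "0 < D" unfolding D_def
    using mpk'_neg[of \<sigma> "y_star \<sigma>"] mph'_pos[of "y_star \<sigma>"] mpk_elast_pos assms(2)
    by (intro divide_pos_pos) auto
  have deriv: "((\<lambda>s. 1 / eps E * (mph (y_star s) - rho E - dh E)) has_real_derivative
      1 / eps E * (mph' (y_star \<sigma>) * D)) (at \<sigma>)"
    unfolding D_def using eps_gt_1
    by (auto intro!: derivative_eq_intros DERIV_chain2[OF DERIV_mph] DERIV_y_star[OF el])
  have ev: "\<forall>\<^sub>F s in nhds \<sigma>. r_star E B \<sigma>2 s = 1 / eps E * (mph (y_star s) - rho E - dh E)"
    using eventually_elasticities[OF el, of 1]
    by (auto elim!: eventually_mono simp: r_star_eq_mph)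
  have "(r_star E B \<sigma>2 has_real_derivative 1 / eps E * (mph' (y_star \<sigma>) * D)) (at \<sigma>)"
    unfolding DERIV_cong_ev[OF refl ev refl] by (rule deriv)
  moreover have "0 < 1 / eps E * (mph' (y_star \<sigma>) * D)"
    using \<open>0 < D\<close> mph'_pos eps_gt_1 by (intro mult_pos_pos) auto
  ultimately show ?thesis unfolding increasing_at_def by blast
qed

lemma increasing_at_k_share_iff:
  assumes el: "\<sigma> \<in> elasticities E B \<sigma>2"
  shows "increasing_at (\<lambda>s. k_share B s (w_star E B \<sigma>2 \<sigma>)) \<sigma> \<longleftrightarrow> 0 < y_star \<sigma>"
proof -
  note \<sigma> = elasticities_bounds(1)[OF el]
  \<comment> \<open>Here the input ratio stays fixed while the elasticity varies; \<open>psi\<close>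
    has derivative \<open>1 / \<sigma>\<^sup>2\<close> at \<open>\<sigma>\<close>.\<close>
  have "((\<lambda>s. psi s * (\<sigma> * y_star \<sigma>)) has_real_derivative y_star \<sigma> / \<sigma>) (at \<sigma>)"
    unfolding psi_def using \<sigma> by (auto intro!: derivative_eq_intros simp: field_simps)
  from increasing_at_share_iff[OF this, of "\<lambda>s. k_share B s (w_star E B \<sigma>2 \<sigma>)"] show ?thesis
    using \<sigma> by (simp add: w_star_eq[OF el] k_share_eq zero_less_divide_iff)
qed

text \<open>Now the steady state moves too, and the derivative to sign is \<open>y + s * D\<close>.
  Multiplied by the positive \<open>G - mpk' \<sigma> y\<close> it becomes
  \<open>y * G - f * L\<close>, since the terms \<open>y * mpk' \<sigma> y\<close> cancel. The power
  mean lies below \<open>1\<close> for positive \<open>y\<close> and above it for negative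
  \<open>y\<close>, so \<open>L\<close> has the sign of \<open>- y\<close> and both terms agree in
  sign.\<close>

lemma increasing_at_k_share_star_iff:
  assumes el: "\<sigma> \<in> elasticities E B \<sigma>2"
  shows "increasing_at (k_share_star E B \<sigma>2) \<sigma> \<longleftrightarrow> 0 < y_star \<sigma>"
proof -
  note \<sigma> = elasticities_bounds[OF el]
  define y s f G D L where "y = y_star \<sigma>" and "s = \<sigma> - 1" and "f = mpk \<sigma> y" and "G = mph' y"
    and "D = mpk_elast \<sigma> y / (mph' y - mpk' \<sigma> y)" and "L = ln (pmean b1 s y)"
  have s: "s \<noteq> 0" using \<sigma> by (simp add: s_def)
  have neg: "0 < G - mpk' \<sigma> y" using mpk'_neg[of \<sigma> y] mph'_pos[of y] by (simp add: G_def)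
  have "((\<lambda>r. (r - 1) * y_star r) has_real_derivative y + s * D) (at \<sigma>)"
    unfolding D_def y_def s_def by (auto intro!: derivative_eq_intros DERIV_y_star[OF el])
  moreover have "\<forall>\<^sub>F r in nhds \<sigma>. k_share_star E B \<sigma>2 r = share ((r - 1) * y_star r)"
    using eventually_elasticities[OF el, of 1] by (auto elim!: eventually_mono simp: k_share_star_eq)
  ultimately have iff: "increasing_at (k_share_star E B \<sigma>2) \<sigma> \<longleftrightarrow> 0 < y + s * D"
    by (rule increasing_at_share_iff)
  have elast: "s * mpk_elast \<sigma> y = - f * L + y * mpk' \<sigma> y"
    unfolding f_def L_def mpk_def mpk_elast_def mpk'_def s_def[symmetric] ln_pmean[OF shares(1,2)]
    using s by (simp add: power2_eq_square field_simps)
  have "(y + s * D) * (G - mpk' \<sigma> y) = y * G - f * L"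
  proof -
    have "D * (G - mpk' \<sigma> y) = mpk_elast \<sigma> y"
      using neg unfolding D_def G_def[symmetric] by simp
    then have "(y + s * D) * (G - mpk' \<sigma> y) = y * (G - mpk' \<sigma> y) + s * mpk_elast \<sigma> y"
      by (simp add: distrib_right)
    then show ?thesis using elast by (simp add: right_diff_distrib)
  qed
  then have "0 < y + s * D \<longleftrightarrow> 0 < y * G - f * L"
    using neg by (metis zero_less_mult_pos2 mult_pos_pos)
  also have "\<dots> \<longleftrightarrow> 0 < y"
  proof -
    have f: "0 < f" and G: "0 < G" using mpk_pos mph'_pos by (simp_all add: f_def G_def)
    consider "y = 0" | "0 < y" | "y < 0" by linarith
    then show ?thesis
    proof cases
      case 2
      have "L < 0" unfolding L_def
        using pmean_strict_antimono[OF shares(1,2) s 2] pmean_pos[OF shares(1,2), of s y] by simp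
      then have "f * L < 0" "0 < y * G" using f G 2 by (simp_all add: mult_pos_neg)
      then show ?thesis using 2 by simp
    next
      case 3
      have "0 < L" unfolding L_def
        using pmean_strict_antimono[OF shares(1,2) s 3] by simp
      then have "0 < f * L" "y * G < 0" using f G 3 by (simp_all add: mult_neg_pos)
      then show ?thesis using 3 by simp
    qed (simp add: L_def)
  qed
  finally show ?thesis using iff by (simp add: y_def)
qed

text \<open>Zeros are compared directly, since integrating a derivative could not cross
  \<open>\<sigma> = 1\<close>. Raising the elasticity makes \<open>excess\<close> positive at the
  old zero, and \<open>excess\<close> decreases in \<open>y\<close>, so the new zero lies to the
  right.\<close>

lemma r_star_strict_mono:
  assumes el: "\<sigma> \<in> elasticities E B \<sigma>2" "\<sigma>' \<in> elasticities E B \<sigma>2"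
    and y: "y_star \<sigma> \<noteq> 0" and less: "\<sigma> < \<sigma>'"
  shows "r_star E B \<sigma>2 \<sigma> < r_star E B \<sigma>2 \<sigma>'"
proof -
  note \<sigma> = elasticities_bounds(2)[OF el(1)] elasticities_bounds(2)[OF el(2)]
  have "0 = excess \<sigma> (y_star \<sigma>)" using excess_y_star[OF el(1)] by simp
  also have "\<dots> < excess \<sigma>' (y_star \<sigma>)"
    unfolding excess_def mpk_def
    using pos(4) pmean_strict_mono_exponent[OF shares(1,2) y, of "\<sigma> - 1" "\<sigma>' - 1"] \<sigma> less by simp
  finally have "y_star \<sigma> < y_star \<sigma>'"
    using excess_y_star[OF el(2)] excess_strict_antimono[OF \<sigma>(2), of "y_star \<sigma>'" "y_star \<sigma>"]
    by (metis less_asym less_irrefl linorder_neqE)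
  from mph_strict_mono[OF this] show ?thesis
    using eps_gt_1 by (simp add: r_star_eq_mph el divide_strict_right_mono)
qed

end

section \<open>Balanced growth paths\<close>

definition regular :: "technology \<Rightarrow> bool" where
  "regular T \<longleftrightarrow> 0 < A1 T \<and> 0 < alpha1 T \<and> alpha1 T < 1 \<and> psi1 T \<noteq> 0 \<and>
     0 < A2 T \<and> 0 < alpha2 T \<and> alpha2 T < 1 \<and> psi2 T \<noteq> 0"

abbreviation "goods_k T \<equiv> ces_mpx (A1 T) (alpha1 T) (psi1 T)"
abbreviation "goods_h T \<equiv> ces_mpy (A1 T) (alpha1 T) (psi1 T)"
abbreviation "educ_k T \<equiv> ces_mpx (A2 T) (alpha2 T) (psi2 T)"
abbreviation "educ_h T \<equiv> ces_mpy (A2 T) (alpha2 T) (psi2 T)"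

lemma interior_foc:
  assumes T: "regular T" and pos: "0 < k" "0 < h" "0 < c" "0 < u" "u < 1" "0 < v" "v < 1"
    and eps: "eps E \<noteq> 1"
    and c: "((\<lambda>x. hamiltonian E T k h x u v lam mu) has_real_derivative 0) (at c)"
    and u: "((\<lambda>x. hamiltonian E T k h c x v lam mu) has_real_derivative 0) (at u)"
    and v: "((\<lambda>x. hamiltonian E T k h c u x lam mu) has_real_derivative 0) (at v)"
    and k: "((\<lambda>x. hamiltonian E T x h c u v lam mu) has_real_derivative Hk) (at k)"
    and h: "((\<lambda>x. hamiltonian E T k x c u v lam mu) has_real_derivative Hh) (at h)"
  defines "w \<equiv> k * v / (h * u)" and "z \<equiv> k * (1 - v) / (h * (1 - u))"
  shows "lam = c powr - eps E"
    and "lam * goods_k T w = mu * educ_k T z"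
    and "lam * goods_h T w = mu * educ_h T z"
    and "Hk = lam * (goods_k T w - dk E)"
    and "Hh = mu * (educ_h T z - dh E)"
proof -
  have T': "0 < alpha1 T" "alpha1 T < 1" "psi1 T \<noteq> 0" "0 < alpha2 T" "alpha2 T < 1" "psi2 T \<noteq> 0"
    using T by (auto simp: regular_def)
  have p: "0 < k * v" "0 < h * u" "0 < k * (1 - v)" "0 < h * (1 - u)" using pos by auto
  \<comment> \<open>The inner function \<open>f\<close> is left general so that one rule serves the
    derivatives in both the stock and the fraction.\<close>
  have goods_x: "((\<lambda>x. ces (A1 T) (alpha1 T) (psi1 T) (f x) (h * u)) has_real_derivative goods_k T w * f') (at a)"
    if "(f has_real_derivative f') (at a)" "f a = k * v" for f f' a
    using DERIV_chain2[of "\<lambda>x. ces (A1 T) (alpha1 T) (psi1 T) x (h * u)" "goods_k T w" f a f']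
      DERIV_ces_x[OF p(1,2) T'(1-3), of "A1 T"] that by (simp add: w_def)
  have goods_y: "((\<lambda>x. ces (A1 T) (alpha1 T) (psi1 T) (k * v) (f x)) has_real_derivative goods_h T w * f') (at a)"
    if "(f has_real_derivative f') (at a)" "f a = h * u" for f f' a
    using DERIV_chain2[of "\<lambda>x. ces (A1 T) (alpha1 T) (psi1 T) (k * v) x" "goods_h T w" f a f']
      DERIV_ces_y[OF p(1,2) T'(1-3), of "A1 T"] that by (simp add: w_def)
  have educ_x: "((\<lambda>x. ces (A2 T) (alpha2 T) (psi2 T) (f x) (h * (1 - u))) has_real_derivative educ_k T z * f') (at a)"
    if "(f has_real_derivative f') (at a)" "f a = k * (1 - v)" for f f' a
    using DERIV_chain2[of "\<lambda>x. ces (A2 T) (alpha2 T) (psi2 T) x (h * (1 - u))" "educ_k T z" f a f']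
      DERIV_ces_x[OF p(3,4) T'(4-6), of "A2 T"] that by (simp add: z_def)
  have educ_y: "((\<lambda>x. ces (A2 T) (alpha2 T) (psi2 T) (k * (1 - v)) (f x)) has_real_derivative educ_h T z * f') (at a)"
    if "(f has_real_derivative f') (at a)" "f a = h * (1 - u)" for f f' a
    using DERIV_chain2[of "\<lambda>x. ces (A2 T) (alpha2 T) (psi2 T) (k * (1 - v)) x" "educ_h T z" f a f']
      DERIV_ces_y[OF p(3,4) T'(4-6), of "A2 T"] that by (simp add: z_def)
  have lin: "((\<lambda>x. a * x) has_real_derivative a) (at y)"
    "((\<lambda>x. x * a) has_real_derivative a) (at y)"
    "((\<lambda>x. a * (1 - x)) has_real_derivative - a) (at y)" for a y :: real
    by (auto intro!: derivative_eq_intros)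
  have "((\<lambda>x. x powr (1 - eps E)) has_real_derivative (1 - eps E) * c powr - eps E) (at c)"
    using has_real_derivative_powr[OF pos(3), of "1 - eps E"] by simp
  from DERIV_cdivide[OF DERIV_diff[OF this DERIV_const[of 1]], of "1 - eps E"]
  have U: "(utility E has_real_derivative c powr - eps E) (at c)"
    using eps unfolding utility_def[abs_def] by simp
  have Dc: "((\<lambda>x. hamiltonian E T k h x u v lam mu) has_real_derivative c powr - eps E - lam) (at c)"
    unfolding hamiltonian_def by (auto intro!: derivative_eq_intros U)
  from DERIV_unique[OF c Dc] show "lam = c powr - eps E" by simp
  have "((\<lambda>x. hamiltonian E T k h c u x lam mu) has_real_derivative
      0 + lam * (goods_k T w * k - 0 - 0) + mu * (educ_k T z * - k - 0)) (at v)"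
    unfolding hamiltonian_def goods_def education_def
    by (intro DERIV_add DERIV_cmult DERIV_diff DERIV_const
        goods_x educ_x lin refl)
  from DERIV_unique[OF v this] have "k * (lam * goods_k T w - mu * educ_k T z) = 0"
    by (auto simp: algebra_simps)
  then show foc_v: "lam * goods_k T w = mu * educ_k T z" using pos by simp
  have "((\<lambda>x. hamiltonian E T k h c x v lam mu) has_real_derivative
      0 + lam * (goods_h T w * h - 0 - 0) + mu * (educ_h T z * - h - 0)) (at u)"
    unfolding hamiltonian_def goods_def education_def
    by (intro DERIV_add DERIV_cmult DERIV_diff DERIV_const
        goods_y educ_y lin refl)
  from DERIV_unique[OF u this] have "h * (lam * goods_h T w - mu * educ_h T z) = 0"
    by (auto simp: algebra_simps)
  then show foc_u: "lam * goods_h T w = mu * educ_h T z" using pos by simp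
  have "((\<lambda>x. hamiltonian E T x h c u v lam mu) has_real_derivative
      0 + lam * (goods_k T w * v - 0 - dk E) + mu * (educ_k T z * (1 - v) - 0)) (at k)"
    unfolding hamiltonian_def goods_def education_def
    by (intro DERIV_add DERIV_cmult DERIV_diff DERIV_const
        goods_x educ_x lin refl)
  from DERIV_unique[OF k this] have "Hk = lam * goods_k T w * v - lam * dk E + mu * educ_k T z * (1 - v)"
    by (simp add: algebra_simps)
  \<comment> \<open>Capital is worth the same at the margin in both sectors, so the fractions
    \<open>v\<close> and \<open>1 - v\<close> add up to one.\<close>
  then show "Hk = lam * (goods_k T w - dk E)" unfolding foc_v[symmetric] by (simp add: algebra_simps)
  have "((\<lambda>x. hamiltonian E T k x c u v lam mu) has_real_derivative
      0 + lam * (goods_h T w * u - 0 - 0) + mu * (educ_h T z * (1 - u) - dh E)) (at h)"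
    unfolding hamiltonian_def goods_def education_def
    by (intro DERIV_add DERIV_cmult DERIV_diff DERIV_const
        goods_y educ_y lin refl)
  from DERIV_unique[OF h this] have "Hh = lam * goods_h T w * u - mu * dh E + mu * educ_h T z * (1 - u)"
    by (simp add: algebra_simps)
  then show "Hh = mu * (educ_h T z - dh E)" unfolding foc_u by (simp add: algebra_simps)
qed

text \<open>Covers the one-sided derivative at the left endpoint, hence time \<open>0\<close>: every
  point of the half-line is a limit of points to its right.\<close>

lemma DERIV_unique_Ici:
  fixes f :: "real \<Rightarrow> real"
  assumes "(f has_real_derivative D) (at t within {a..})" "(f has_real_derivative D') (at t within {a..})"
    and "a \<le> t"
  shows "D = D'"
proof -
  have "at_right t \<le> at t within {a..}" using \<open>a \<le> t\<close> by (intro at_le) auto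
  then have "at t within {a..} \<noteq> bot"
    using trivial_limit_at_right_real[of t] by (metis bot.extremum_uniqueI)
  then show ?thesis
    using assms tendsto_unique unfolding has_field_derivative_iff by blast
qed

lemma grows_at_proportional:
  assumes "grows_at x g" "\<And>t. 0 \<le> t \<Longrightarrow> y t = a * x t"
  shows "grows_at y g"
  unfolding grows_at_def
proof (intro allI impI)
  fix t :: real assume t: "0 \<le> t"
  have "((\<lambda>t. a * x t) has_real_derivative a * (g * x t)) (at t within {0..})"
    using assms(1) t by (intro DERIV_cmult) (simp add: grows_at_def)
  also have "a * (g * x t) = g * y t" using assms(2)[OF t] by simp
  finally have "((\<lambda>t. a * x t) has_real_derivative g * y t) (at t within {0..})" .
  then show "(y has_real_derivative g * y t) (at t within {0..})"
    by (rule has_field_derivative_transform_within[where d = 1]) (use t assms(2) in auto)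
qed

lemma grows_at_unique:
  assumes "grows_at x g" "grows_at x g'" "x 0 \<noteq> 0"
  shows "g = g'"
proof -
  have "g * x 0 = g' * x 0"
    using assms(1,2) by (intro DERIV_unique_Ici[of x _ 0 0]) (simp_all add: grows_at_def)
  then show ?thesis using assms(3) by simp
qed

text \<open>Injectivity of \<open>goods_k T\<close> is what turns a marginal product constant in
  time into a constant input ratio.\<close>

lemma balanced_growth_path_conditions:
  assumes T: "regular T" and eps: "eps E \<noteq> 0" "eps E \<noteq> 1"
    and inj: "inj_on (goods_k T) {0<..}"
    and bgp: "balanced_growth_path E T k h c u v"
  obtains g w z where "0 < w" "0 < z"
    "\<And>t. 0 \<le> t \<Longrightarrow> k t * v t / (h t * u t) = w"
    "goods_k T w = rho E + dk E + eps E * g"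
    "educ_h T z = rho E + dh E + eps E * g"
    "goods_k T w * educ_h T z = goods_h T w * educ_k T z"
    "grows_at k g" "grows_at h g" "grows_at c g"
    "grows_at (\<lambda>t. goods T (k t) (h t) (u t) (v t)) g"
    "grows_at (\<lambda>t. education T (k t) (h t) (u t) (v t)) g"
proof -
  from bgp obtain lam mu gk gh gc where path: "feasible_path E T k h c u v"
    and mp: "maximum_principle E T k h c u v lam mu"
    and uv: "\<And>t. 0 \<le> t \<Longrightarrow> u t = u 0 \<and> v t = v 0"
    and gk: "grows_at k gk" and gh: "grows_at h gh" and gc: "grows_at c gc"
    unfolding balanced_growth_path_def by blast
  have T': "0 < A1 T" "0 < alpha1 T" "alpha1 T < 1" "psi1 T \<noteq> 0"
    "0 < A2 T" "0 < alpha2 T" "alpha2 T < 1" "psi2 T \<noteq> 0"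
    using T by (auto simp: regular_def)
  have pos: "0 < k t" "0 < h t" "0 < c t" "0 < u t" "u t < 1" "0 < v t" "v t < 1" if "0 \<le> t" for t
    using path that by (auto simp: feasible_path_def)
  define wt zt where "wt t = k t * v t / (h t * u t)" and "zt t = k t * (1 - v t) / (h t * (1 - u t))" for t
  have wz_pos: "0 < wt t" "0 < zt t" if "0 \<le> t" for t
    using pos[OF that] by (simp_all add: wt_def zt_def)
  have foc: "lam t = c t powr - eps E" "lam t * goods_k T (wt t) = mu t * educ_k T (zt t)"
      "lam t * goods_h T (wt t) = mu t * educ_h T (zt t)"
      "(lam has_real_derivative lam t * (rho E + dk E - goods_k T (wt t))) (at t within {0..})"
      "(mu has_real_derivative mu t * (rho E + dh E - educ_h T (zt t))) (at t within {0..})"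
    if t: "0 \<le> t" for t
  proof -
    from mp t obtain Hk Hh
      where m: "((\<lambda>x. hamiltonian E T (k t) (h t) x (u t) (v t) (lam t) (mu t)) has_real_derivative 0) (at (c t))"
      "((\<lambda>x. hamiltonian E T (k t) (h t) (c t) x (v t) (lam t) (mu t)) has_real_derivative 0) (at (u t))"
      "((\<lambda>x. hamiltonian E T (k t) (h t) (c t) (u t) x (lam t) (mu t)) has_real_derivative 0) (at (v t))"
      "((\<lambda>x. hamiltonian E T x (h t) (c t) (u t) (v t) (lam t) (mu t)) has_real_derivative Hk) (at (k t))"
      "((\<lambda>x. hamiltonian E T (k t) x (c t) (u t) (v t) (lam t) (mu t)) has_real_derivative Hh) (at (h t))"
      and l: "(lam has_real_derivative rho E * lam t - Hk) (at t within {0..})"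
      and n: "(mu has_real_derivative rho E * mu t - Hh) (at t within {0..})"
      unfolding maximum_principle_def by blast
    note i = interior_foc[OF T pos[OF t] eps(2) m, folded wt_def zt_def]
    show "lam t = c t powr - eps E" "lam t * goods_k T (wt t) = mu t * educ_k T (zt t)"
      "lam t * goods_h T (wt t) = mu t * educ_h T (zt t)" by (fact i)+
    show "(lam has_real_derivative lam t * (rho E + dk E - goods_k T (wt t))) (at t within {0..})"
      by (rule DERIV_cong[OF l]) (simp add: i(4) algebra_simps)
    show "(mu has_real_derivative mu t * (rho E + dh E - educ_h T (zt t))) (at t within {0..})"
      by (rule DERIV_cong[OF n]) (simp add: i(5) algebra_simps)
  qed
  have lam_pos: "0 < lam t" if "0 \<le> t" for t using foc(1)[OF that] pos[OF that] by simp
  have lam_grows: "grows_at lam (- eps E * gc)"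
    unfolding grows_at_def
  proof (intro allI impI)
    fix t :: real assume t: "0 \<le> t"
    have "(c has_real_derivative gc * c t) (at t within {0..})" using gc t by (simp add: grows_at_def)
    then have "((\<lambda>t. c t powr - eps E) has_real_derivative
        - eps E * c t powr (- eps E - 1) * (gc * c t)) (at t within {0..})"
      using pos(3)[OF t] by (auto intro!: derivative_eq_intros)
    moreover have "c t powr (- eps E - 1) * c t = lam t"
      using pos(3)[OF t] foc(1)[OF t] by (simp add: powr_diff)
    then have "- eps E * c t powr (- eps E - 1) * (gc * c t) = - eps E * gc * lam t"
      by (metis mult.assoc mult.commute)
    ultimately have "((\<lambda>t. c t powr - eps E) has_real_derivative - eps E * gc * lam t) (at t within {0..})"
      by (simp only:)
    then show "(lam has_real_derivative - eps E * gc * lam t) (at t within {0..})"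
      by (rule has_field_derivative_transform_within[where d = 1]) (use t foc(1) in auto)
  qed
  have mpk: "goods_k T (wt t) = rho E + dk E + eps E * gc" if t: "0 \<le> t" for t
  proof -
    have "lam t * (rho E + dk E - goods_k T (wt t)) = - eps E * gc * lam t"
      using lam_grows t by (intro DERIV_unique_Ici[OF foc(4)[OF t]]) (auto simp: grows_at_def)
    then have "lam t * (rho E + dk E + eps E * gc - goods_k T (wt t)) = 0"
      by (simp add: algebra_simps)
    then show ?thesis using lam_pos[OF t] by simp
  qed
  define w where "w = wt 0"
  have wt: "wt t = w" if "0 \<le> t" for t
    using inj_onD[OF inj] wz_pos[OF that] wz_pos[of 0] mpk[OF that] mpk[of 0] by (simp add: w_def)
  define z where "z = zt 0"
  have wz: "0 < w" "0 < z" using wz_pos[of 0] by (simp_all add: w_def z_def)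
  \<comment> \<open>With \<open>u\<close> and \<open>v\<close> constant, a constant ratio
    \<open>w\<close> makes \<open>h\<close> proportional to \<open>k\<close>; the input ratio in
    education is then constant as well.\<close>
  have h: "h t = h 0 / k 0 * k t" if "0 \<le> t" for t
  proof -
    have "k t * v 0 / (h t * u 0) = k 0 * v 0 / (h 0 * u 0)"
      using wt[OF that] uv[OF that] by (simp add: wt_def w_def)
    then show ?thesis using pos[OF that] pos[of 0] by (simp add: field_simps)
  qed
  have zt: "zt t = z" if "0 \<le> t" for t
    using h[OF that] uv[OF that] pos[OF that] pos[of 0] by (simp add: zt_def z_def)
  have mu: "mu t = goods_h T w / educ_h T z * lam t" if "0 \<le> t" for t
    using foc(3)[OF that] ces_mpy_pos[OF T'(6,7,5) wz(2), of "psi2 T"]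
    by (simp add: wt zt that field_simps)
  have mu_pos: "0 < mu 0"
    using mu[of 0] lam_pos[of 0] ces_mpy_pos[OF T'(6,7,5) wz(2)] ces_mpy_pos[OF T'(2,3,1) wz(1)]
    by simp
  have mph: "educ_h T z = rho E + dh E + eps E * gc"
  proof -
    have "grows_at mu (- eps E * gc)" by (rule grows_at_proportional[OF lam_grows mu])
    then have "mu 0 * (rho E + dh E - educ_h T z) = - eps E * gc * mu 0"
      using DERIV_unique_Ici[OF foc(5)[of 0], of "- eps E * gc * mu 0"] zt[of 0] by (simp add: grows_at_def)
    then have "mu 0 * (rho E + dh E + eps E * gc - educ_h T z) = 0"
      by (simp add: algebra_simps)
    then show ?thesis using mu_pos by simp
  qed
  have mrs: "goods_k T w * educ_h T z = goods_h T w * educ_k T z"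
  proof -
    have "lam 0 * goods_k T w * (mu 0 * educ_h T z) = mu 0 * educ_k T z * (lam 0 * goods_h T w)"
      using foc(2,3)[of 0] by (simp add: wt zt)
    then have "lam 0 * mu 0 * (goods_k T w * educ_h T z) = lam 0 * mu 0 * (goods_h T w * educ_k T z)"
      by (simp add: mult_ac)
    then show ?thesis using lam_pos[of 0] mu_pos by simp
  qed
  \<comment> \<open>Both stocks scale by \<open>k t / k 0\<close>, and CES output is homogeneous of
    degree one.\<close>
  have goods: "goods T (k t) (h t) (u t) (v t) = goods T (k 0) (h 0) (u 0) (v 0) / k 0 * k t"
    and educ: "education T (k t) (h t) (u t) (v t) = education T (k 0) (h 0) (u 0) (v 0) / k 0 * k t"
    if t: "0 \<le> t" for t
  proof -
    have s: "0 < k t / k 0" "k t = k t / k 0 * k 0" "h t = k t / k 0 * h 0"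
      using pos[OF t] pos[of 0] h[OF t] by simp_all
    have 1: "k t * v t = k t / k 0 * (k 0 * v 0)" "h t * u t = k t / k 0 * (h 0 * u 0)"
      "k t * (1 - v t) = k t / k 0 * (k 0 * (1 - v 0))" "h t * (1 - u t) = k t / k 0 * (h 0 * (1 - u 0))"
      using s(2,3) uv[OF t] pos[of 0] by simp_all
    have p: "0 < k 0 * v 0" "0 < h 0 * u 0" "0 < k 0 * (1 - v 0)" "0 < h 0 * (1 - u 0)"
      using pos[of 0] by simp_all
    show "goods T (k t) (h t) (u t) (v t) = goods T (k 0) (h 0) (u 0) (v 0) / k 0 * k t"
      unfolding goods_def 1 ces_scale[OF s(1) p(1,2) T'(2-4)] by simp
    show "education T (k t) (h t) (u t) (v t) = education T (k 0) (h 0) (u 0) (v 0) / k 0 * k t"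
      unfolding education_def 1 ces_scale[OF s(1) p(3,4) T'(6-8)] by simp
  qed
  \<comment> \<open>The accumulation equation of \<open>k\<close> makes consumption a fixed multiple
    of \<open>k\<close>, which forces the growth rates \<open>gk\<close> and \<open>gc\<close> to
    coincide.\<close>
  have c: "c t = (goods T (k 0) (h 0) (u 0) (v 0) / k 0 - dk E - gk) * k t" if t: "0 \<le> t" for t
  proof -
    have "(k has_real_derivative goods T (k t) (h t) (u t) (v t) - c t - dk E * k t) (at t within {0..})"
      using path t by (simp add: feasible_path_def)
    moreover have "(k has_real_derivative gk * k t) (at t within {0..})"
      using gk t by (simp add: grows_at_def)
    ultimately have "goods T (k t) (h t) (u t) (v t) - c t - dk E * k t = gk * k t"
      using t by (rule DERIV_unique_Ici)
    then show ?thesis unfolding goods[OF t] by (simp add: algebra_simps)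
  qed
  have "grows_at c gk" by (rule grows_at_proportional[OF gk c])
  then have "gk = gc" using gc pos(3)[of 0] by (intro grows_at_unique) auto
  with gk have k: "grows_at k gc" by simp
  show thesis
    by (rule that[OF wz _ mpk[of 0, unfolded wt[of 0, OF order.refl] ] mph mrs k grows_at_proportional[OF k h] gc
          grows_at_proportional[OF k goods] grows_at_proportional[OF k educ]])
      (use wt in \<open>simp_all add: wt_def\<close>)
qed

section \<open>Balanced growth paths of the normalized technology\<close>

context normalized_model
begin

lemma normalized_regular:
  assumes "0 < \<sigma>" "\<sigma> \<noteq> 1"
  shows "regular (normalized B \<sigma> \<sigma>2)"
  unfolding regular_def normalized_simps
  using norm_alpha_bounds[OF pos(1,3)] norm_alpha_bounds[OF pos(2,3)]
    norm_A_pos[OF pos(1,3)] norm_A_pos[OF pos(2,3)] psi_simps(1)[OF assms] psi_simps(1)[OF \<sigma>2] baseline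
  unfolding valid_baseline_def by simp

lemma normalized_goods_k_inj:
  assumes "0 < \<sigma>" "\<sigma> \<noteq> 1" and T: "T = normalized B \<sigma> \<sigma>2"
  shows "inj_on (goods_k T) {0<..}"
proof (rule inj_onI)
  fix w w' assume w: "w \<in> {0<..}" "w' \<in> {0<..}" "goods_k T w = goods_k T w'"
  define y where "y w = ln (w / W) / \<sigma>" for w
  have eq: "w = W * exp (\<sigma> * y w)" if "0 < w" for w
    using that assms pos by (simp add: y_def)
  have "mpk \<sigma> (y w) = mpk \<sigma> (y w')"
    using w eq goods_mpx[OF assms, of "y w"] goods_mpx[OF assms, of "y w'"] by simp
  then have "y w = y w'"
    using mpk_strict_antimono[OF assms(2)] by (metis less_irrefl linorder_neqE)
  then show "w = w'" using eq[of w] eq[of w'] w by simp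
qed

text \<open>Both sectors have the same baseline marginal rate of substitution, so taking logarithms
  of the equality leaves \<open>ln (w / W) / \<sigma> = ln (z / X) / \<sigma>2\<close>: a single
  \<open>y\<close> describes both input ratios.\<close>

lemma equal_mrs_ratio:
  assumes "0 < \<sigma>" "\<sigma> \<noteq> 1" and T: "T = normalized B \<sigma> \<sigma>2"
    and wz: "0 < w" "0 < z" and eq: "goods_k T w * educ_h T z = goods_h T w * educ_k T z"
  defines "y \<equiv> ln (w / W) / \<sigma>"
  shows "w = W * exp (\<sigma> * y)" "z = X * exp (\<sigma>2 * y)"
proof -
  show "w = W * exp (\<sigma> * y)" using assms pos by (simp add: y_def)
  have r: "0 < A1 T" "0 < alpha1 T" "alpha1 T < 1" "0 < A2 T" "0 < alpha2 T" "alpha2 T < 1"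
    using normalized_regular[OF assms(1,2)] by (auto simp: regular_def T)
  have "goods_h T w * educ_h T z * (alpha1 T / (1 - alpha1 T) * w powr (psi1 T - 1))
      = goods_h T w * educ_h T z * (alpha2 T / (1 - alpha2 T) * z powr (psi2 T - 1))"
    using eq unfolding ces_mpx_eq_mpy[OF r(2,3)] ces_mpx_eq_mpy[OF r(5,6)] by (simp add: mult_ac)
  then have "alpha1 T / (1 - alpha1 T) * w powr (psi1 T - 1) = alpha2 T / (1 - alpha2 T) * z powr (psi2 T - 1)"
  proof (subst (asm) mult_left_cancel)
    show "goods_h T w * educ_h T z \<noteq> 0"
      using ces_mpy_pos[OF r(2,3,1) wz(1), of "psi1 T"] ces_mpy_pos[OF r(5,6,4) wz(2), of "psi2 T"] by simp
  qed
  then have "W powr (1 - psi \<sigma>) * w powr (psi \<sigma> - 1) = X powr (1 - psi \<sigma>2) * z powr (psi \<sigma>2 - 1)"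
    unfolding T normalized_simps norm_alpha_mrs[OF pos(1,3)] norm_alpha_mrs[OF pos(2,3)]
    using pos by simp
  from arg_cong[OF this, of ln]
  have "(1 - psi \<sigma>) * ln W + (psi \<sigma> - 1) * ln w = (1 - psi \<sigma>2) * ln X + (psi \<sigma>2 - 1) * ln z"
    using pos wz by (simp add: ln_mult ln_powr)
  then have "(1 - psi \<sigma>) * (ln w - ln W) = (1 - psi \<sigma>2) * (ln z - ln X)"
    by (simp add: algebra_simps)
  then have "y = ln (z / X) / \<sigma>2"
    unfolding psi_simps(2)[OF assms(1,2)] psi_simps(2)[OF \<sigma>2] y_def using pos wz by (simp add: ln_div)
  then show "z = X * exp (\<sigma>2 * y)" using pos wz \<sigma>2 by simp
qed

lemma balanced_growth_path_rate:
  assumes \<sigma>: "0 < \<sigma>" "\<sigma> \<noteq> 1" and T: "T = normalized B \<sigma> \<sigma>2"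
    and bgp: "balanced_growth_path E T k h c u v"
  shows "\<sigma> \<in> elasticities E B \<sigma>2"
    and "\<And>t. 0 \<le> t \<Longrightarrow> k t * v t / (h t * u t) = w_star E B \<sigma>2 \<sigma>"
    and "grows_at k (r_star E B \<sigma>2 \<sigma>)" "grows_at h (r_star E B \<sigma>2 \<sigma>)" "grows_at c (r_star E B \<sigma>2 \<sigma>)"
      "grows_at (\<lambda>t. goods T (k t) (h t) (u t) (v t)) (r_star E B \<sigma>2 \<sigma>)"
      "grows_at (\<lambda>t. education T (k t) (h t) (u t) (v t)) (r_star E B \<sigma>2 \<sigma>)"
proof -
  have "regular T" "eps E \<noteq> 0" "eps E \<noteq> 1" using normalized_regular[OF \<sigma>] T eps_gt_1 by simp_all
  note conditions = balanced_growth_path_conditions[OF this normalized_goods_k_inj[OF \<sigma> T] bgp]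
  obtain g w z where wz: "0 < w" "0 < z" and w: "\<And>t. 0 \<le> t \<Longrightarrow> k t * v t / (h t * u t) = w"
    and mpk: "goods_k T w = rho E + dk E + eps E * g"
    and mph: "educ_h T z = rho E + dh E + eps E * g"
    and mrs: "goods_k T w * educ_h T z = goods_h T w * educ_k T z"
    and grows: "grows_at k g" "grows_at h g" "grows_at c g"
      "grows_at (\<lambda>t. goods T (k t) (h t) (u t) (v t)) g"
      "grows_at (\<lambda>t. education T (k t) (h t) (u t) (v t)) g"
    by (rule conditions) (rule that)
  define y where "y = ln (w / W) / \<sigma>"
  note w_eq = equal_mrs_ratio[OF \<sigma> T wz mrs, folded y_def]
  have 1: "mpk \<sigma> y = rho E + dk E + eps E * g"
    using mpk unfolding w_eq(1) goods_mpx[OF \<sigma> T] .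
  have 2: "mph y = rho E + dh E + eps E * g"
    using mph unfolding w_eq(2) education_mpy[OF T] .
  \<comment> \<open>The unknown rate \<open>g\<close> cancels between the two marginal product
    conditions.\<close>
  have y: "excess \<sigma> y = 0" by (simp add: excess_def 1 2)
  with \<sigma> show el: "\<sigma> \<in> elasticities E B \<sigma>2" unfolding elasticities_iff by blast
  have y_star: "y_star \<sigma> = y" using \<sigma>(2) y by (rule y_star_eqI)
  show "k t * v t / (h t * u t) = w_star E B \<sigma>2 \<sigma>" if "0 \<le> t" for t
    unfolding w[OF that] w_star_eq[OF el] y_star by (rule w_eq(1))
  have "r_star E B \<sigma>2 \<sigma> = g"
    unfolding r_star_eq[OF el] y_star 1 using eps_gt_1 by simp
  with grows show "grows_at k (r_star E B \<sigma>2 \<sigma>)" "grows_at h (r_star E B \<sigma>2 \<sigma>)"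
    "grows_at c (r_star E B \<sigma>2 \<sigma>)"
    "grows_at (\<lambda>t. goods T (k t) (h t) (u t) (v t)) (r_star E B \<sigma>2 \<sigma>)"
    "grows_at (\<lambda>t. education T (k t) (h t) (u t) (v t)) (r_star E B \<sigma>2 \<sigma>)"
    by simp_all
qed

end

text \<open>The growth of the share with the elasticity is read in two ways, at a fixed input ratio
  and along the steady state. The last clause compares distant elasticities, also across
  \<open>\<sigma>1 = 1\<close>, which the pointwise derivatives cannot do.\<close>

theorem mainTheorem3:
  fixes E :: environment and B :: baseline and \<sigma>2 :: real
  assumes "eps E > 1"
    and "valid_baseline B"
    and "0 < \<sigma>2" and "\<sigma>2 \<noteq> 1"
  shows
    "(\<forall>\<sigma>1 k h c u v. 0 < \<sigma>1 \<and> \<sigma>1 \<noteq> 1 \<and> balanced_growth_path E (normalized B \<sigma>1 \<sigma>2) k h c u v \<longrightarrow>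
        \<sigma>1 \<in> elasticities E B \<sigma>2 \<and>
        (\<forall>t\<ge>0. k t * v t / (h t * u t) = w_star E B \<sigma>2 \<sigma>1) \<and>
        grows_at k (r_star E B \<sigma>2 \<sigma>1) \<and>
        grows_at h (r_star E B \<sigma>2 \<sigma>1) \<and>
        grows_at c (r_star E B \<sigma>2 \<sigma>1) \<and>
        grows_at (\<lambda>t. goods (normalized B \<sigma>1 \<sigma>2) (k t) (h t) (u t) (v t)) (r_star E B \<sigma>2 \<sigma>1) \<and>
        grows_at (\<lambda>t. education (normalized B \<sigma>1 \<sigma>2) (k t) (h t) (u t) (v t)) (r_star E B \<sigma>2 \<sigma>1))
     \<and>
     (\<forall>\<sigma>1 \<in> elasticities E B \<sigma>2.
        r_star E B \<sigma>2 \<sigma>1 =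
          1 / eps E * (y1bar B / (kbar B * vbar B) * k_share_bar B
            * (k_share_bar B / k_share_star E B \<sigma>2 \<sigma>1) powr ((1 - psi \<sigma>1) / psi \<sigma>1)
            - rho E - dk E))
     \<and>
     (\<forall>\<sigma>1 \<in> elasticities E B \<sigma>2.
        (w_star E B \<sigma>2 \<sigma>1 > wbar B \<longrightarrow> increasing_at (r_star E B \<sigma>2) \<sigma>1) \<and>
        (w_star E B \<sigma>2 \<sigma>1 > wbar B \<longleftrightarrow>
           increasing_at (\<lambda>\<sigma>. k_share B \<sigma> (w_star E B \<sigma>2 \<sigma>1)) \<sigma>1) \<and>
        (w_star E B \<sigma>2 \<sigma>1 > wbar B \<longleftrightarrow> increasing_at (k_share_star E B \<sigma>2) \<sigma>1))
     \<and>
     strict_mono_on {\<sigma>1 \<in> elasticities E B \<sigma>2. w_star E B \<sigma>2 \<sigma>1 > wbar B} (r_star E B \<sigma>2)"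
proof -
  interpret normalized_model E B \<sigma>2 using assms by unfold_locales
  show ?thesis
  proof (intro conjI allI impI ballI; (elim conjE)?)
    fix \<sigma>1 k h c u v
    assume "0 < \<sigma>1" "\<sigma>1 \<noteq> 1" "balanced_growth_path E (normalized B \<sigma>1 \<sigma>2) k h c u v"
    note rate = balanced_growth_path_rate[OF this(1,2) refl this(3)]
    show "\<sigma>1 \<in> elasticities E B \<sigma>2" "grows_at k (r_star E B \<sigma>2 \<sigma>1)" "grows_at h (r_star E B \<sigma>2 \<sigma>1)"
      "grows_at c (r_star E B \<sigma>2 \<sigma>1)"
      "grows_at (\<lambda>t. goods (normalized B \<sigma>1 \<sigma>2) (k t) (h t) (u t) (v t)) (r_star E B \<sigma>2 \<sigma>1)"
      "grows_at (\<lambda>t. education (normalized B \<sigma>1 \<sigma>2) (k t) (h t) (u t) (v t)) (r_star E B \<sigma>2 \<sigma>1)"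
      by (fact rate)+
    show "k t * v t / (h t * u t) = w_star E B \<sigma>2 \<sigma>1" if "0 \<le> t" for t
      using that by (rule rate)
  next
    fix \<sigma>1 assume el: "\<sigma>1 \<in> elasticities E B \<sigma>2"
    show "r_star E B \<sigma>2 \<sigma>1 = 1 / eps E * (y1bar B / (kbar B * vbar B) * k_share_bar B
            * (k_share_bar B / k_share_star E B \<sigma>2 \<sigma>1) powr ((1 - psi \<sigma>1) / psi \<sigma>1)
            - rho E - dk E)" by (rule r_star_share[OF el])
    show "increasing_at (r_star E B \<sigma>2) \<sigma>1" if "w_star E B \<sigma>2 \<sigma>1 > wbar B"
      using that unfolding w_star_gt_iff[OF el] by (intro increasing_at_r_star[OF el]) simp
    show "w_star E B \<sigma>2 \<sigma>1 > wbar B \<longleftrightarrow> increasing_at (\<lambda>\<sigma>. k_share B \<sigma> (w_star E B \<sigma>2 \<sigma>1)) \<sigma>1"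
      unfolding w_star_gt_iff[OF el] increasing_at_k_share_iff[OF el] by (rule refl)
    show "w_star E B \<sigma>2 \<sigma>1 > wbar B \<longleftrightarrow> increasing_at (k_share_star E B \<sigma>2) \<sigma>1"
      unfolding w_star_gt_iff[OF el] increasing_at_k_share_star_iff[OF el] by (rule refl)
  next
    show "strict_mono_on {\<sigma>1 \<in> elasticities E B \<sigma>2. w_star E B \<sigma>2 \<sigma>1 > wbar B} (r_star E B \<sigma>2)"
      by (rule strict_mono_onI) (auto intro: r_star_strict_mono simp: w_star_gt_iff)
  qed
qed

end
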